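(* For every integer $d\ge 2$ there exists a constant $c>0$ such that for every sufficiently large prime power $q$ and every real number $k \geq 1+cq^{-1/d}$, there is a collection $\mathcal{C}=\mathcal{C}(q,k)$ of point sets in $\mathbb{F}^d_q$ satisfying: (i) every general position set in $\mathbb{F}^d_q$ is contained in some member of $\mathcal{C}$; (ii) $|C|\le kq$ for all $C\in \mathcal{C}$; and (iii) $|\mathcal{C}|\le 2^{\, c \cdot (q/\min\{k-1,\,1\})^{\frac{d}{d+1}} (\log q)^2}$.
   Context: $\mathbb{F}_q$ is the finite field with $q$ elements. A hyperplane in $\mathbb{F}_q^d$ is a $(d-1)$-dimensional affine subspace; a point set is in general position if no $d+1$ of its points lie in a common hyperplane. $\log$ is in base $2$. *)

theory Defs
  imports
    "Jordan_Normal_Form.Missing_VectorSpace"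
    "HOL-Number_Theory.Prime_Powers"
begin

text \<open>
  The field is a record \<open>F\<close> whose carrier is a set of natural numbers.  This keeps it
  an object that can be quantified after the constant \<open>c\<close>, which a type of class
  \<open>field\<close> would not allow, and loses no generality: every finite field is isomorphic to
  one of this kind.  The points of \<open>F\<^sup>d\<close> are the extensional functions from
  \<open>{..<d}\<close> to \<open>carrier F\<close>.
\<close>

abbreviation coord_space :: "nat ring \<Rightarrow> nat \<Rightarrow> (nat, nat \<Rightarrow> nat) module"
  where "coord_space F d \<equiv> ring.func_space F {..<d}"

definition affine_subspace ::
  "('a, 'm) ring_scheme \<Rightarrow> ('a, 'b, 'n) module_scheme \<Rightarrow> nat \<Rightarrow> 'b set \<Rightarrow> bool"
  where "affine_subspace K V n H \<longleftrightarrow>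
    (\<exists>p\<in>carrier V. \<exists>W. VectorSpace.subspace K W V \<and>
        vectorspace.fin_dim K (V\<lparr>carrier := W\<rparr>) \<and>
        vectorspace.dim K (V\<lparr>carrier := W\<rparr>) = n \<and>
        H = (\<lambda>w. p \<oplus>\<^bsub>V\<^esub> w) ` W)"

definition hyperplane :: "nat ring \<Rightarrow> nat \<Rightarrow> (nat \<Rightarrow> nat) set \<Rightarrow> bool"
  where "hyperplane F d H \<longleftrightarrow> affine_subspace F (coord_space F d) (d - 1) H"

definition general_position :: "nat ring \<Rightarrow> nat \<Rightarrow> (nat \<Rightarrow> nat) set \<Rightarrow> bool"
  where "general_position F d S \<longleftrightarrow>
    S \<subseteq> carrier (coord_space F d) \<and>
    \<not> (\<exists>T\<subseteq>S. card T = d + 1 \<and> (\<exists>H. hyperplane F d H \<and> T \<subseteq> H))"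

end

theory Submission
  imports Defs "HOL-Analysis.Convex"
begin

text \<open>
  This is a graph container argument in the style of Kleitman and Winston, applied to an
  auxiliary graph read off from a small part \<open>T\<close> of the general position set \<open>S\<close>.
  Fix \<open>T \<subseteq> S\<close> with about \<open>\<surd>q\<close> points and join two points outside \<open>T\<close> when they
  lie in a common hyperplane with some \<open>d - 1\<close> points of \<open>T\<close>, so that \<open>S - T\<close> is
  independent. The space is covered by \<open>q + 1\<close> hyperplanes through \<open>d - 1\<close> given points, so
  each \<open>(d - 1)\<close>-subset of \<open>T\<close> joins at least \<open>N (N - q - 1) / (q + 1)\<close> ordered pairs of an
  \<open>N\<close>-point set. An exchange argument shows that a pair is joined by only
  \<open>O(|T|\<^sup>d\<^sup>-\<^sup>2)\<close> of these subsets. Hence as long as \<open>N - q - 1\<close> is positive there is a vertex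
  of degree at least a constant times \<open>|T| (N - q - 1) / q\<close>: selecting it shrinks \<open>N - q - 1\<close>
  by a factor \<open>1 - \<Omega>(q\<^sup>-\<^sup>1\<^sup>/\<^sup>2)\<close>, and \<open>O(\<surd>q log q)\<close> selections suffice. This gives
  \<open>2 powr O(\<surd>q (log q)\<^sup>2)\<close> containers (sets smaller than \<open>T\<close> are their own containers), which is within the required bound because
  \<open>d / (d + 1) \<ge> 1 / 2\<close>.
\<close>

subsection \<open>Containers for independent sets of a graph\<close>

text \<open>\<open>L\<close> is a potential that bounds how often a vertex can be selected.
  Excluding the vertex given by \<open>step\<close> costs one point of \<open>A\<close>; including
  it costs its neighbourhood and lowers \<open>L\<close> by at least 1. Selections occur at no more
  than about \<open>L\<close> of at most \<open>card A\<close> stages, and the resulting count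
  satisfies the recursion because N^L + N^(L-1) \<le> (N+1)^L.\<close>

lemma graph_containers:
  fixes adj :: "'a \<Rightarrow> 'a \<Rightarrow> bool" and L :: "real \<Rightarrow> real" and m :: real
  assumes "finite A" and L_nonneg: "\<And>x. 0 \<le> L x" and L_mono: "mono L"
    and step: "\<And>B. B \<subseteq> A \<Longrightarrow> m < real (card B) \<Longrightarrow>
      \<exists>v\<in>B. {u\<in>B. adj v u} \<noteq> {} \<and>
        L (real (card B) - real (card {u\<in>B. adj v u})) + 1 \<le> L (real (card B))"
  shows "\<exists>\<C>\<subseteq>Pow A. (\<forall>I\<subseteq>A. (\<forall>u\<in>I. \<forall>v\<in>I. \<not> adj u v) \<longrightarrow> (\<exists>C\<in>\<C>. I \<subseteq> C)) \<and>
    (\<forall>C\<in>\<C>. real (card C) \<le> m) \<and> real (card \<C>) \<le> real (card A + 1) powr L (real (card A))"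
  using assms(1) step
proof (induction rule: finite_psubset_induct)
  case (psubset A)
  show ?case
  proof (cases "real (card A) \<le> m")
    case True
    have "1 \<le> real (card A + 1) powr L (real (card A))"
      using L_nonneg by (intro ge_one_powr_ge_zero) auto
    then show ?thesis using True
      by (intro exI[of _ "{A}"]) auto
  next
    case False
    define a where "a = card A"
    have "\<exists>v\<in>A. {u\<in>A. adj v u} \<noteq> {} \<and>
        L (real (card A) - real (card {u\<in>A. adj v u})) + 1 \<le> L (real (card A))"
      using False by (intro psubset.prems) auto
    then obtain v where v: "v \<in> A" and ne: "{u\<in>A. adj v u} \<noteq> {}"
      and drop: "L (real a - real (card {u\<in>A. adj v u})) + 1 \<le> L (real a)"
      unfolding a_def by blast
    let ?N = "{u\<in>A. adj v u}"
    \<comment> \<open>An independent set either avoids \<open>v\<close> or avoids all neighbours of \<open>v\<close>. In the second case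
      \<open>v\<close> stays in the set, so no selected vertex has to be added to the container afterwards.\<close>
    have a1: "1 \<le> a" using v psubset.hyps by (simp add: a_def Suc_le_eq card_gt_0_iff) blast
    have less1: "A - {v} \<subset> A" and less2: "A - ?N \<subset> A" using v ne by blast+
    have IH: "\<exists>\<C>\<subseteq>Pow B. (\<forall>I\<subseteq>B. (\<forall>u\<in>I. \<forall>v\<in>I. \<not> adj u v) \<longrightarrow> (\<exists>C\<in>\<C>. I \<subseteq> C)) \<and>
        (\<forall>C\<in>\<C>. real (card C) \<le> m) \<and> real (card \<C>) \<le> real (card B + 1) powr L (real (card B))"
      if "B \<subset> A" for B
      using that by (intro psubset.IH psubset.prems) auto
    from IH[OF less1] obtain \<C>1 where C1: "\<C>1 \<subseteq> Pow (A - {v})"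
      "\<forall>I\<subseteq>A - {v}. (\<forall>u\<in>I. \<forall>v\<in>I. \<not> adj u v) \<longrightarrow> (\<exists>C\<in>\<C>1. I \<subseteq> C)"
      "\<forall>C\<in>\<C>1. real (card C) \<le> m"
      "real (card \<C>1) \<le> real (card (A - {v}) + 1) powr L (real (card (A - {v})))"
      by (elim exE conjE)
    from IH[OF less2] obtain \<C>2 where C2: "\<C>2 \<subseteq> Pow (A - ?N)"
      "\<forall>I\<subseteq>A - ?N. (\<forall>u\<in>I. \<forall>v\<in>I. \<not> adj u v) \<longrightarrow> (\<exists>C\<in>\<C>2. I \<subseteq> C)"
      "\<forall>C\<in>\<C>2. real (card C) \<le> m"
      "real (card \<C>2) \<le> real (card (A - ?N) + 1) powr L (real (card (A - ?N)))"
      by (elim exE conjE)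
    have N: "card (A - ?N) = a - card ?N" "card ?N \<le> a" "1 \<le> card ?N"
      using psubset.hyps ne by (auto simp: a_def card_Diff_subset card_mono Suc_le_eq card_gt_0_iff)
    have b1: "real (card \<C>1) \<le> real a powr L (real a)"
    proof -
      have "card (A - {v}) + 1 = a" using v psubset.hyps a1 by (simp add: a_def)
      then have "real (card \<C>1) \<le> real a powr L (real (card (A - {v})))" using C1(4) by simp
      also have "\<dots> \<le> real a powr L (real a)"
        using a1 psubset.hyps by (intro powr_mono monoD[OF L_mono]) (auto simp: a_def card_mono)
      finally show ?thesis .
    qed
    \<comment> \<open>The neighbourhood is nonempty, so \<open>card (A - ?N) + 1\<close> is at most
      \<open>a\<close>; hence the \<open>+ 1\<close> in the base does no harm here.\<close>
    have b2: "real (card \<C>2) \<le> real a powr (L (real a) - 1)"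
    proof -
      have "real (card \<C>2) \<le> real (card (A - ?N) + 1) powr L (real (card (A - ?N)))" by (rule C2(4))
      also have "\<dots> \<le> real a powr L (real (card (A - ?N)))"
        using N a1 L_nonneg by (intro powr_mono2) auto
      also have "\<dots> \<le> real a powr (L (real a) - 1)"
        using drop N a1 by (intro powr_mono) (auto simp: of_nat_diff)
      finally show ?thesis .
    qed
    \<comment> \<open>Enlarging the base from \<open>a\<close> to \<open>a + 1\<close> below is
      monotone only for a nonnegative exponent \<open>L (real a) - 1\<close>.\<close>
    have L1: "1 \<le> L (real a)" using drop L_nonneg[of "real a - real (card ?N)"] by linarith
    have "real (card (\<C>1 \<union> \<C>2)) \<le> real a powr L (real a) + real a powr (L (real a) - 1)"
      using b1 b2 card_Un_le[of \<C>1 \<C>2] by linarith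
    also have "\<dots> = real a powr (L (real a) - 1) * (real a + 1)"
      using a1 by (simp add: powr_diff field_simps)
    also have "\<dots> \<le> real (a + 1) powr (L (real a) - 1) * (real a + 1)"
      using L1 by (intro mult_right_mono powr_mono2) auto
    also have "\<dots> = real (a + 1) powr L (real a)"
      by (simp add: powr_diff add.commute)
    finally have bound: "real (card (\<C>1 \<union> \<C>2)) \<le> real (a + 1) powr L (real a)" .
    have cover: "\<exists>C\<in>\<C>1 \<union> \<C>2. I \<subseteq> C" if I: "I \<subseteq> A" "\<forall>u\<in>I. \<forall>v\<in>I. \<not> adj u v" for I
    proof (cases "v \<in> I")
      case True
      then have "I \<subseteq> A - ?N" using I by blast
      then have "\<exists>C\<in>\<C>2. I \<subseteq> C" by (rule C2(2)[rule_format]) (use I in auto)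
      then show ?thesis by blast
    next
      case False
      then have "I \<subseteq> A - {v}" using I by blast
      then have "\<exists>C\<in>\<C>1. I \<subseteq> C" by (rule C1(2)[rule_format]) (use I in auto)
      then show ?thesis by blast
    qed
    have sub: "\<C>1 \<union> \<C>2 \<subseteq> Pow A" using C1(1) C2(1) by blast
    show ?thesis
    proof (intro exI[of _ "\<C>1 \<union> \<C>2"] conjI)
      show "\<forall>C\<in>\<C>1 \<union> \<C>2. real (card C) \<le> m" using C1(3) C2(3) by blast
    qed (use sub cover bound in \<open>auto simp: a_def\<close>)
  qed
qed

text \<open>An upper bound for the number of steps, each shrinking \<open>x - Q\<close> by a factor
  1 - 1/D, until \<open>x - Q\<close> is at most \<open>y\<close>. The summand 1 pays for the last
  step, the one that jumps below \<open>y\<close>, where the potential becomes 0.\<close>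

definition log_potential :: "real \<Rightarrow> real \<Rightarrow> real \<Rightarrow> real \<Rightarrow> real"
  where "log_potential Q y D x = (if x - Q \<le> y then 0 else 1 + D * ln ((x - Q) / y))"

lemma log_potential_nonneg: "0 < y \<Longrightarrow> 0 < D \<Longrightarrow> 0 \<le> log_potential Q y D x"
  by (auto simp: log_potential_def intro!: add_nonneg_nonneg mult_nonneg_nonneg ln_ge_zero)

lemma log_potential_mono:
  assumes "0 < y" "0 < D"
  shows "mono (log_potential Q y D)"
proof (rule monoI)
  fix x x' :: real
  assume le: "x \<le> x'"
  show "log_potential Q y D x \<le> log_potential Q y D x'"
  proof (cases "x - Q \<le> y")
    case True
    then show ?thesis using log_potential_nonneg[OF assms] by (simp add: log_potential_def)
  next
    case False
    then have "ln ((x - Q) / y) \<le> ln ((x' - Q) / y)"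
      using le assms by (intro ln_mono) (auto intro!: divide_right_mono)
    then show ?thesis using False le assms by (simp add: log_potential_def)
  qed
qed

text \<open>Removing \<open>e\<close> multiplies \<open>x - Q\<close> by at most 1 - 1/D, and ln t
  \<le> t - 1 turns this into a loss of at least 1/D in the logarithm.\<close>

lemma log_potential_drop:
  assumes "0 < y" "0 < D" "y < x - Q" "(x - Q) / D \<le> e"
  shows "log_potential Q y D (x - e) + 1 \<le> log_potential Q y D x"
proof (cases "x - e - Q \<le> y")
  case True
  then show ?thesis using assms by (simp add: log_potential_def)
next
  case False
  define z where "z = x - Q"
  have z: "0 < z" "0 < z - e" using assms False by (auto simp: z_def)
  have "ln ((z - e) / y) = ln (z / y) + ln ((z - e) / z)"
    using z assms by (simp add: ln_div)
  also have "ln ((z - e) / z) \<le> (z - e) / z - 1"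
    using z by (intro ln_le_minus_one) auto
  also have "(z - e) / z - 1 \<le> - (1 / D)"
    using z assms(2,4) by (simp add: z_def field_simps)
  finally have "D * ln ((z - e) / y) \<le> D * (ln (z / y) - 1 / D)"
    using assms by (intro mult_left_mono) auto
  then have "D * ln ((z - e) / y) + 1 \<le> D * ln (z / y)"
    using assms by (simp add: right_diff_distrib)
  then show ?thesis using False assms
    by (simp add: log_potential_def z_def algebra_simps)
qed

section \<open>Counting small subsets and monochromatic pairs\<close>

lemma card_subsets_le:
  assumes "finite P"
  shows "card {T. T \<subseteq> P \<and> card T \<le> t} \<le> (card P + 1) ^ t"
proof (induction t)
  case 0
  have "{T. T \<subseteq> P \<and> card T \<le> 0} = {{}}"
    using assms by (auto dest: finite_subset)
  then show ?case by simp
next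
  case (Suc t)
  let ?F = "\<lambda>t. {T. T \<subseteq> P \<and> card T \<le> t}"
  have fin: "finite (?F t)" using assms by (auto intro: finite_subset[of _ "Pow P"])
  have "?F (Suc t) \<subseteq> ?F t \<union> (\<lambda>(x, T). insert x T) ` (P \<times> ?F t)"
  proof
    fix T assume T: "T \<in> ?F (Suc t)"
    show "T \<in> ?F t \<union> (\<lambda>(x, T). insert x T) ` (P \<times> ?F t)"
    proof (cases "T = {}")
      case False
      then obtain x where x: "x \<in> T" by blast
      have "card (T - {x}) \<le> t" using T x assms finite_subset by fastforce
      then have "(x, T - {x}) \<in> P \<times> ?F t" "T = (\<lambda>(x, T). insert x T) (x, T - {x})"
        using T x by auto
      then show ?thesis by blast
    qed simp
  qed
  then have "card (?F (Suc t)) \<le> card (?F t \<union> (\<lambda>(x, T). insert x T) ` (P \<times> ?F t))"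
    using fin assms by (intro card_mono) auto
  also have "\<dots> \<le> card (?F t) + card P * card (?F t)"
    using card_image_le[of "P \<times> ?F t" "\<lambda>(x, T). insert x T"] fin assms
      card_Un_le[of "?F t" "(\<lambda>(x, T). insert x T) ` (P \<times> ?F t)"]
    by (simp add: card_cartesian_product)
  also have "\<dots> = (card P + 1) * card (?F t)" by simp
  also have "\<dots> \<le> (card P + 1) ^ Suc t" unfolding power_Suc using Suc by (intro mult_le_mono2)
  finally show ?case .
qed

text \<open>Cauchy-Schwarz applied to the fibre sizes of \<open>f\<close>, after which the diagonal
  is discarded. In the application \<open>f\<close> sends a point to a member of a pencil of
  hyperplanes containing it, and \<open>Q\<close> is \<open>q + 1\<close>.\<close>

lemma card_monochromatic_pairs:
  fixes B :: "'a set" and f :: "'a \<Rightarrow> 'b" and Q :: real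
  assumes "finite B" and "real (card (f ` B)) \<le> Q" and "0 < Q"
  shows "real (card B) * (real (card B) - Q) / Q
    \<le> real (card {e \<in> B \<times> B. fst e \<noteq> snd e \<and> f (fst e) = f (snd e)})"
proof -
  let ?n = "\<lambda>c. card {x\<in>B. f x = c}"
  have sumn: "(\<Sum>c\<in>f ` B. ?n c) = card B"
    using sum.image_gen[OF assms(1), of "\<lambda>_. 1::nat" f] by simp
  have "real (card B) ^ 2 = (\<Sum>c\<in>f ` B. real (?n c)) ^ 2"
    by (simp flip: sumn)
  also have "\<dots> \<le> (\<Sum>c\<in>f ` B. real (?n c) ^ 2) * real (card (f ` B))"
    by (rule sum_squared_le_sum_of_squares)
  also have "\<dots> \<le> (\<Sum>c\<in>f ` B. real (?n c) ^ 2) * Q"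
    using assms by (intro mult_left_mono sum_nonneg) auto
  finally have 1: "real (card B) ^ 2 / Q \<le> (\<Sum>c\<in>f ` B. real (?n c) ^ 2)"
    using assms by (simp add: field_simps)
  let ?E = "{e \<in> B \<times> B. f (fst e) = f (snd e)}"
  have "?E = (\<Union>c\<in>f ` B. {x\<in>B. f x = c} \<times> {x\<in>B. f x = c})" by auto
  then have "card ?E = (\<Sum>c\<in>f ` B. card ({x\<in>B. f x = c} \<times> {x\<in>B. f x = c}))"
    using assms(1) by (simp only:, intro card_UN_disjoint) auto
  then have 2: "real (card ?E) = (\<Sum>c\<in>f ` B. real (?n c) ^ 2)"
    by (simp add: card_cartesian_product power2_eq_square)
  let ?E' = "{e \<in> B \<times> B. fst e \<noteq> snd e \<and> f (fst e) = f (snd e)}"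
  have "?E \<subseteq> ?E' \<union> (\<lambda>x. (x, x)) ` B" by auto
  then have "card ?E \<le> card (?E' \<union> (\<lambda>x. (x, x)) ` B)"
    using assms(1) by (intro card_mono) auto
  also have "\<dots> \<le> card ?E' + card ((\<lambda>x. (x, x)) ` B)" by (rule card_Un_le)
  also have "card ((\<lambda>x. (x, x)) ` B) \<le> card B" using assms(1) by (rule card_image_le)
  finally have 3: "real (card ?E) \<le> real (card ?E') + real (card B)" by linarith
  have "real (card B) * (real (card B) - Q) / Q = real (card B) ^ 2 / Q - real (card B)"
    using assms(3) by (simp add: field_simps power2_eq_square)
  then show ?thesis using 1 2 3 by linarith
qed

subsection \<open>General position in incidence structures\<close>

text \<open>The three facts about affine hyperplanes that the container argument uses.
  \<open>exchange\<close> is linear dependence in combinatorial form: if \<open>d + 1\<close> points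
  lie on a hyperplane, some dependence between them involves a point of \<open>R\<close>, and that
  point lies on every hyperplane through the others. Members of \<open>\<H>\<close> may be empty,
  which leaves room for the hyperplane at infinity.\<close>

locale hyperplane_incidence =
  fixes P :: "'a set" and \<H> :: "'a set set" and d q :: nat
  assumes d2: "2 \<le> d" and finite_points: "finite P"
    and through_points: "X \<subseteq> P \<Longrightarrow> card X \<le> d \<Longrightarrow> \<exists>H\<in>\<H>. X \<subseteq> H"
    and pencil: "R \<subseteq> P \<Longrightarrow> card R = d - 1 \<Longrightarrow>
      \<exists>h. h ` P \<subseteq> \<H> \<and> card (h ` P) \<le> q + 1 \<and> (\<forall>x\<in>P. insert x R \<subseteq> h x)"
    and exchange: "R \<subseteq> P \<Longrightarrow> card R = d - 1 \<Longrightarrow> u \<in> P - R \<Longrightarrow> w \<in> P - R \<Longrightarrow> u \<noteq> w \<Longrightarrow>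
      H \<in> \<H> \<Longrightarrow> insert u (insert w R) \<subseteq> H \<Longrightarrow>
      \<exists>r\<in>R. \<forall>H'\<in>\<H>. insert u (insert w (R - {r})) \<subseteq> H' \<longrightarrow> r \<in> H'"
begin

definition gen_pos :: "'a set \<Rightarrow> bool"
  where "gen_pos S \<longleftrightarrow> S \<subseteq> P \<and> \<not> (\<exists>T\<subseteq>S. card T = d + 1 \<and> (\<exists>H\<in>\<H>. T \<subseteq> H))"

definition linked :: "'a set \<Rightarrow> 'a \<Rightarrow> 'a \<Rightarrow> bool"
  where "linked T u w \<longleftrightarrow> u \<noteq> w \<and>
    (\<exists>R\<subseteq>T. card R = d - 1 \<and> (\<exists>H\<in>\<H>. insert u (insert w R) \<subseteq> H))"

lemma gen_pos_subset: "gen_pos S \<Longrightarrow> T \<subseteq> S \<Longrightarrow> gen_pos T"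
  unfolding gen_pos_def by blast

lemma gen_pos_finite: "gen_pos S \<Longrightarrow> finite S"
  using finite_subset[OF _ finite_points] by (simp add: gen_pos_def)

lemma gen_pos_card_hyperplane:
  assumes "gen_pos T" "H \<in> \<H>"
  shows "card (T \<inter> H) \<le> d"
proof (rule ccontr)
  assume "\<not> ?thesis"
  then have "d + 1 \<le> card (T \<inter> H)" by simp
  then obtain X where "X \<subseteq> T \<inter> H" "card X = d + 1" by (rule obtain_subset_with_card_n)
  then have "X \<subseteq> T" "card X = d + 1" "X \<subseteq> H" by auto
  then show False using assms unfolding gen_pos_def by blast
qed

lemma gen_pos_not_linked:
  assumes "gen_pos S" "T \<subseteq> S" "u \<in> S - T" "w \<in> S - T"
  shows "\<not> linked T u w"
proof
  assume "linked T u w"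
  then obtain R H where R: "u \<noteq> w" "R \<subseteq> T" "card R = d - 1" "H \<in> \<H>" "insert u (insert w R) \<subseteq> H"
    unfolding linked_def by blast
  have "finite R"
    using R(2) assms(2) by (intro finite_subset[OF _ gen_pos_finite[OF assms(1)]]) auto
  moreover have "u \<notin> R" "w \<notin> R" using R assms by auto
  ultimately have "card (insert u (insert w R)) = d + 1" using R d2 by simp
  moreover have "insert u (insert w R) \<subseteq> S" using R(2) assms(2-4) by auto
  moreover have "\<exists>H\<in>\<H>. insert u (insert w R) \<subseteq> H" using R by auto
  ultimately show False using assms(1) unfolding gen_pos_def by blast
qed

text \<open>By \<open>exchange\<close>, each linking set \<open>R\<close> contains a point
  \<open>r\<close> that lies on every hyperplane through \<open>u\<close>, \<open>w\<close> and
  \<open>R - {r}\<close>. Thus \<open>R\<close> is encoded by the (d-2)-set \<open>R - {r}\<close>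
  and by a point of \<open>T\<close> on one hyperplane fixed for that set, and general position
  leaves at most \<open>d\<close> choices for this point.\<close>

lemma card_linking_sets:
  assumes T: "gen_pos T" and u: "u \<in> P - T" and w: "w \<in> P - T" and "u \<noteq> w"
  shows "card {R. R \<subseteq> T \<and> card R = d - 1 \<and> (\<exists>H\<in>\<H>. insert u (insert w R) \<subseteq> H)}
    \<le> (card T choose (d - 2)) * d"
proof -
  let ?X = "{R. R \<subseteq> T \<and> card R = d - 1 \<and> (\<exists>H\<in>\<H>. insert u (insert w R) \<subseteq> H)}"
  let ?Q = "{Q. Q \<subseteq> T \<and> card Q = d - 2}"
  have TP: "T \<subseteq> P" using T by (simp add: gen_pos_def)
  have finT: "finite T" using T by (rule gen_pos_finite)
  have "\<exists>r. r \<in> R \<and> (\<forall>H\<in>\<H>. insert u (insert w (R - {r})) \<subseteq> H \<longrightarrow> r \<in> H)"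
    if X: "R \<in> ?X" for R
  proof -
    from X obtain H where R: "R \<subseteq> T" "card R = d - 1" "H \<in> \<H>" "insert u (insert w R) \<subseteq> H" by auto
    have "\<exists>r\<in>R. \<forall>H\<in>\<H>. insert u (insert w (R - {r})) \<subseteq> H \<longrightarrow> r \<in> H"
      using R u w TP \<open>u \<noteq> w\<close> by (intro exchange[of R u w H]) auto
    then show ?thesis by (simp only: Bex_def)
  qed
  then have "\<forall>R\<in>?X. \<exists>r. r \<in> R \<and> (\<forall>H\<in>\<H>. insert u (insert w (R - {r})) \<subseteq> H \<longrightarrow> r \<in> H)"
    by (rule ballI)
  from bchoice[OF this] obtain r where
    "\<forall>R\<in>?X. r R \<in> R \<and> (\<forall>H\<in>\<H>. insert u (insert w (R - {r R})) \<subseteq> H \<longrightarrow> r R \<in> H)"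
    by (elim exE)
  then have r: "\<And>R. R \<in> ?X \<Longrightarrow> r R \<in> R"
    "\<And>R H. R \<in> ?X \<Longrightarrow> H \<in> \<H> \<Longrightarrow> insert u (insert w (R - {r R})) \<subseteq> H \<Longrightarrow> r R \<in> H"
    by (simp_all only: ball_simps Ball_def)
  \<comment> \<open>\<open>Q\<close> together with \<open>u\<close> and \<open>w\<close> has at most
    \<open>d\<close> points. The hyperplane \<open>h Q\<close> is chosen from \<open>Q\<close>
    alone, not from \<open>R\<close>, so all sets \<open>R\<close> with the same \<open>Q\<close>
    have their \<open>r\<close> on the same hyperplane.\<close>
  have "\<forall>Q\<in>?Q. \<exists>H. H \<in> \<H> \<and> insert u (insert w Q) \<subseteq> H"
  proof
    fix Q assume Q: "Q \<in> ?Q"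
    then have "finite Q" by (intro finite_subset[OF _ finT]) auto
    then have "card (insert u (insert w Q)) \<le> d"
      using Q d2 by (auto simp: card_insert_if)
    moreover have "insert u (insert w Q) \<subseteq> P" using Q TP u w by auto
    ultimately have "\<exists>H\<in>\<H>. insert u (insert w Q) \<subseteq> H" by (intro through_points)
    then show "\<exists>H. H \<in> \<H> \<and> insert u (insert w Q) \<subseteq> H" by (simp only: Bex_def)
  qed
  from bchoice[OF this] obtain h where
    h: "\<forall>Q\<in>?Q. h Q \<in> \<H> \<and> insert u (insert w Q) \<subseteq> h Q" by (elim exE)
  have finQ: "finite ?Q" using finT by (auto intro: finite_subset[of _ "Pow T"])
  have fin: "finite (SIGMA Q:?Q. T \<inter> h Q)" using finQ finT by (intro finite_SigmaI) auto
  have Q_of: "R - {r R} \<in> ?Q" if "R \<in> ?X" for R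
  proof -
    have "R \<subseteq> T" "card R = d - 1" using that by auto
    then have "card (R - {r R}) = d - 2"
      using r(1)[OF that] d2 by (subst card_Diff_singleton) auto
    then show ?thesis using \<open>R \<subseteq> T\<close> by auto
  qed
  have "inj_on (\<lambda>R. (R - {r R}, r R)) ?X"
  proof (rule inj_onI)
    fix R R' assume "R \<in> ?X" "R' \<in> ?X" and eq: "(R - {r R}, r R) = (R' - {r R'}, r R')"
    then have "insert (r R) (R - {r R}) = R" "insert (r R') (R' - {r R'}) = R'"
      by (simp_all only: insert_Diff r(1))
    then show "R = R'" using eq by (metis prod.inject)
  qed
  moreover have "(\<lambda>R. (R - {r R}, r R)) ` ?X \<subseteq> (SIGMA Q:?Q. T \<inter> h Q)"
  proof (rule image_subsetI)
    fix R assume X: "R \<in> ?X"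
    have "r R \<in> h (R - {r R})" using bspec[OF h Q_of[OF X]] by (intro r(2)[OF X]) auto
    then show "(R - {r R}, r R) \<in> (SIGMA Q:?Q. T \<inter> h Q)"
      using r(1)[OF X] X by (intro SigmaI Q_of[OF X] IntI) auto
  qed
  ultimately have "card ?X \<le> card (SIGMA Q:?Q. T \<inter> h Q)"
    using fin by (rule card_inj_on_le)
  also have "\<dots> = (\<Sum>Q\<in>?Q. card (T \<inter> h Q))" using finQ finT by simp
  also have "\<dots> \<le> (\<Sum>Q\<in>?Q. d)"
    using h by (intro sum_mono gen_pos_card_hyperplane[OF T]) auto
  also have "\<dots> = (card T choose (d - 2)) * d" using n_subsets[OF finT] by simp
  finally show ?thesis .
qed

text \<open>Double counting of incidences between (d-1)-sets \<open>R\<close> and pairs that the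
  pencil through \<open>R\<close> maps to one hyperplane: each \<open>R\<close> has many such pairs
  by \<open>card_monochromatic_pairs\<close>, and each pair occurs for few \<open>R\<close> by
  \<open>card_linking_sets\<close>.\<close>

lemma card_linked_pairs:
  assumes T: "gen_pos T" and B: "B \<subseteq> P - T"
  shows "real (card T choose (d - 1)) * (real (card B) * (real (card B) - (real q + 1)) / (real q + 1))
    \<le> real ((card T choose (d - 2)) * d) * real (card {e \<in> B \<times> B. linked T (fst e) (snd e)})"
proof -
  let ?\<R> = "{R. R \<subseteq> T \<and> card R = d - 1}"
  let ?E = "{e \<in> B \<times> B. linked T (fst e) (snd e)}"
  let ?c = "real (card B) * (real (card B) - (real q + 1)) / (real q + 1)"
  have TP: "T \<subseteq> P" using T by (simp add: gen_pos_def)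
  have finT: "finite T" using T by (rule gen_pos_finite)
  have finB: "finite B" using B by (intro finite_subset[OF _ finite_points]) auto
  have finR: "finite ?\<R>" using finT by (auto intro: finite_subset[of _ "Pow T"])
  have finE: "finite ?E" using finB by auto
  have "\<forall>R\<in>?\<R>. \<exists>h. h ` P \<subseteq> \<H> \<and> card (h ` P) \<le> q + 1 \<and> (\<forall>x\<in>P. insert x R \<subseteq> h x)"
    using TP by (intro ballI pencil) auto
  from bchoice[OF this] obtain h where
    "\<forall>R\<in>?\<R>. h R ` P \<subseteq> \<H> \<and> card (h R ` P) \<le> q + 1 \<and> (\<forall>x\<in>P. insert x R \<subseteq> h R x)"
    by (elim exE)
  then have h: "\<And>R. R \<in> ?\<R> \<Longrightarrow> h R ` P \<subseteq> \<H>"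
    "\<And>R. R \<in> ?\<R> \<Longrightarrow> card (h R ` P) \<le> q + 1"
    "\<And>R x. R \<in> ?\<R> \<Longrightarrow> x \<in> P \<Longrightarrow> insert x R \<subseteq> h R x"
    by (simp_all only: Ball_def)
  let ?p = "\<lambda>R e. fst e \<noteq> snd e \<and> h R (fst e) = h R (snd e)"
  have sub: "{e \<in> B \<times> B. ?p R e} \<subseteq> ?E" if R: "R \<in> ?\<R>" for R
  proof clarsimp
    fix u w assume "u \<in> B" "w \<in> B" "u \<noteq> w" and eq: "h R u = h R w"
    then have "u \<in> P" "w \<in> P" using B by auto
    then have "insert u (insert w R) \<subseteq> h R u" "h R u \<in> \<H>"
      using h(3)[OF R, of u] h(3)[OF R, of w] h(1)[OF R] eq by auto
    then show "linked T u w" using R \<open>u \<noteq> w\<close> unfolding linked_def by auto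
  qed
  have "real (card T choose (d - 1)) * ?c = (\<Sum>R\<in>?\<R>. ?c)" using n_subsets[OF finT] by simp
  also have "\<dots> \<le> (\<Sum>R\<in>?\<R>. real (card {e \<in> B \<times> B. ?p R e}))"
  proof (intro sum_mono card_monochromatic_pairs)
    fix R assume R: "R \<in> ?\<R>"
    have "card (h R ` B) \<le> card (h R ` P)" using B finite_points by (intro card_mono) auto
    then show "real (card (h R ` B)) \<le> real q + 1" using h(2)[OF R] by linarith
  qed (use finB in auto)
  \<comment> \<open>Monochromatic pairs are linked, so every inner count can run over the one set
    \<open>?E\<close>; this makes the two sums interchangeable.\<close>
  also have "\<dots> = (\<Sum>R\<in>?\<R>. \<Sum>e\<in>?E. if ?p R e then 1 else 0)"
  proof (intro sum.cong refl)
    fix R assume R: "R \<in> ?\<R>"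
    have "{e \<in> B \<times> B. ?p R e} = {e \<in> ?E. ?p R e}" using sub[OF R] by blast
    then show "real (card {e \<in> B \<times> B. ?p R e}) = (\<Sum>e\<in>?E. if ?p R e then 1 else 0)"
      using finE by (simp add: sum.If_cases Int_def conj_ac)
  qed
  also have "\<dots> = (\<Sum>e\<in>?E. \<Sum>R\<in>?\<R>. if ?p R e then 1 else 0)" by (rule sum.swap)
  also have "\<dots> \<le> (\<Sum>e\<in>?E. real ((card T choose (d - 2)) * d))"
  proof (intro sum_mono)
    fix e assume e: "e \<in> ?E"
    obtain u w where uw: "e = (u, w)" by (cases e)
    let ?X = "{R. R \<subseteq> T \<and> card R = d - 1 \<and> (\<exists>H\<in>\<H>. insert u (insert w R) \<subseteq> H)}"
    have "(\<Sum>R\<in>?\<R>. if ?p R e then 1 else 0) = real (card {R \<in> ?\<R>. ?p R e})"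
      using finR by (simp add: sum.If_cases Int_def conj_ac)
    also have "card {R \<in> ?\<R>. ?p R e} \<le> card ?X"
    proof (intro card_mono subsetI)
      show "finite ?X" by (rule finite_subset[OF _ finR]) auto
      fix R assume "R \<in> {R \<in> ?\<R>. ?p R e}"
      then have R: "R \<in> ?\<R>" and eq: "h R u = h R w" using uw by auto
      have "u \<in> P" "w \<in> P" using B e uw by auto
      then have "insert u (insert w R) \<subseteq> h R u" "h R u \<in> \<H>"
        using h(3)[OF R, of u] h(3)[OF R, of w] h(1)[OF R] eq by auto
      then show "R \<in> ?X" using R by auto
    qed
    also have "card ?X \<le> (card T choose (d - 2)) * d"
      using e uw B by (intro card_linking_sets[OF T]) (auto simp: linked_def)
    finally show "(\<Sum>R\<in>?\<R>. if ?p R e then 1 else 0) \<le> real ((card T choose (d - 2)) * d)"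
      by simp
  qed
  also have "\<dots> = real ((card T choose (d - 2)) * d) * real (card ?E)" by simp
  finally show ?thesis .
qed

text \<open>If all degrees were smaller, the sum of the degrees would contradict
  \<open>card_linked_pairs\<close>. The size s + d - 2 of \<open>T\<close> is chosen so that the
  quotient of the binomial coefficients for d - 1 and d - 2 is exactly s / (d - 1).\<close>

lemma linked_max_degree:
  assumes T: "gen_pos T" "card T = s + d - 2" "0 < s" and B: "B \<subseteq> P - T"
    and large: "real q + 1 < real (card B)"
  shows "\<exists>v\<in>B. (real (card B) - (real q + 1)) / ((real q + 1) * real (d * (d - 1)) / real s)
    \<le> real (card {u\<in>B. linked T v u})"
proof (rule ccontr)
  let ?N = "real (card B)" and ?Q = "real q + 1"
  let ?deg = "\<lambda>v. card {u\<in>B. linked T v u}"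
  let ?E = "{e \<in> B \<times> B. linked T (fst e) (snd e)}"
  let ?b = "card T choose (d - 2)"
  assume "\<not> ?thesis"
  then have small: "real (?deg v) < (?N - ?Q) / (?Q * real (d * (d - 1)) / real s)" if "v \<in> B" for v
    using that by force
  have finB: "finite B" using B by (intro finite_subset[OF _ finite_points]) auto
  have ne: "B \<noteq> {}" using large by auto
  have "?E = (SIGMA v:B. {u\<in>B. linked T v u})" by auto
  then have "real (card ?E) = (\<Sum>v\<in>B. real (?deg v))" using finB by simp
  also have "\<dots> < (\<Sum>v\<in>B. (?N - ?Q) / (?Q * real (d * (d - 1)) / real s))"
    using small finB ne by (intro sum_strict_mono) auto
  also have "\<dots> = ?N * ((?N - ?Q) / (?Q * real (d * (d - 1)) / real s))" by simp
  finally have E: "real (card ?E) < ?N * ((?N - ?Q) / (?Q * real (d * (d - 1)) / real s))" .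
  have "0 < ?b" using T by simp
  \<comment> \<open>The absorption identity (k+1) C(n,k+1) = (n-k) C(n,k) with k = d - 2, where n -
    k is \<open>s\<close>.\<close>
  have "Suc (d - 2) * (card T choose Suc (d - 2)) = (card T - (d - 2)) * ?b"
    by (simp only: binomial_absorption binomial_absorb_comp)
  moreover have "Suc (d - 2) = d - 1" using d2 by simp
  moreover have "card T - (d - 2) = s" using T d2 by simp
  ultimately have ch: "(d - 1) * (card T choose (d - 1)) = s * ?b" by simp
  have arith: "b * d * (x * (y / (Q * (d * e) / s))) = s * b / e * (x * y / Q)"
    if "d \<noteq> 0" "e \<noteq> 0" "Q \<noteq> 0" "s \<noteq> 0" for b d e x y Q s :: real
    using that by (simp add: field_simps)
  have "real (card T choose (d - 1)) * (?N * (?N - ?Q) / ?Q) \<le> real (?b * d) * real (card ?E)"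
    by (rule card_linked_pairs[OF T(1) B])
  also have "\<dots> < real (?b * d) * (?N * ((?N - ?Q) / (?Q * real (d * (d - 1)) / real s)))"
    using E \<open>0 < ?b\<close> d2 by (intro mult_strict_left_mono) auto
  also have "\<dots> = real (s * ?b) / real (d - 1) * (?N * (?N - ?Q) / ?Q)"
    using arith[of "real d" "real (d - 1)" ?Q "real s"] d2 T(3) by (simp only: of_nat_mult)
  also have "\<dots> = real (card T choose (d - 1)) * (?N * (?N - ?Q) / ?Q)"
    using d2 by (simp flip: ch)
  finally show False by simp
qed

text \<open>\<open>graph_containers\<close> is applied to the graph \<open>linked T\<close> on
  \<open>P - T\<close>, in which \<open>S - T\<close> is independent; \<open>T\<close> is added to
  every container afterwards, which accounts for \<open>card T\<close> in the size bound.\<close>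

lemma containers_over_fingerprint:
  assumes T: "gen_pos T" "card T = s + d - 2" "0 < s"
    and y: "1 \<le> m - (real q + 1)" and "1 \<le> card P"
  shows "\<exists>\<C>\<subseteq>Pow P. (\<forall>S. gen_pos S \<and> T \<subseteq> S \<longrightarrow> (\<exists>C\<in>\<C>. S \<subseteq> C)) \<and>
    (\<forall>C\<in>\<C>. real (card C) \<le> m + real (card T)) \<and>
    real (card \<C>) \<le> (real (card P) + 1) powr
      (1 + (real q + 1) * real (d * (d - 1)) / real s * ln (real (card P)))"
proof -
  let ?Q = "real q + 1" and ?D = "(real q + 1) * real (d * (d - 1)) / real s"
  let ?y = "m - (real q + 1)"
  let ?L = "log_potential ?Q ?y ?D"
  have D: "0 < ?D" using d2 T(3) by simp
  have y0: "0 < ?y" using y by simp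
  have TP: "T \<subseteq> P" using T by (simp add: gen_pos_def)
  have finT: "finite T" using T(1) by (rule gen_pos_finite)
  have "\<exists>\<C>\<subseteq>Pow (P - T). (\<forall>I\<subseteq>P - T. (\<forall>u\<in>I. \<forall>v\<in>I. \<not> linked T u v) \<longrightarrow> (\<exists>C\<in>\<C>. I \<subseteq> C)) \<and>
    (\<forall>C\<in>\<C>. real (card C) \<le> m) \<and>
    real (card \<C>) \<le> real (card (P - T) + 1) powr ?L (real (card (P - T)))"
  proof (rule graph_containers[OF _ log_potential_nonneg[OF y0 D] log_potential_mono[OF y0 D]])
    show "finite (P - T)" using finite_points by simp
    fix B assume B: "B \<subseteq> P - T" "m < real (card B)"
    have "?Q < real (card B)" using B y by linarith
    then obtain v where v: "v \<in> B" "(real (card B) - ?Q) / ?D \<le> real (card {u\<in>B. linked T v u})"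
      using linked_max_degree[OF T B(1)] by blast
    have "0 < (real (card B) - ?Q) / ?D" using \<open>?Q < real (card B)\<close> by (intro divide_pos_pos[OF _ D]) simp
    then have "{u\<in>B. linked T v u} \<noteq> {}" using v(2) by (metis card.empty of_nat_0 not_le)
    moreover have "?L (real (card B) - real (card {u\<in>B. linked T v u})) + 1 \<le> ?L (real (card B))"
      using B(2) v(2) by (intro log_potential_drop y0 D) auto
    ultimately show "\<exists>v\<in>B. {u\<in>B. linked T v u} \<noteq> {} \<and>
        ?L (real (card B) - real (card {u\<in>B. linked T v u})) + 1 \<le> ?L (real (card B))"
      using v(1) by blast
  qed
  then obtain \<C> where C: "\<C> \<subseteq> Pow (P - T)"
    "\<forall>I\<subseteq>P - T. (\<forall>u\<in>I. \<forall>v\<in>I. \<not> linked T u v) \<longrightarrow> (\<exists>C\<in>\<C>. I \<subseteq> C)"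
    "\<forall>C\<in>\<C>. real (card C) \<le> m"
    "real (card \<C>) \<le> real (card (P - T) + 1) powr ?L (real (card (P - T)))"
    by (elim exE conjE)
  have finC: "finite \<C>" by (rule finite_subset[OF C(1)]) (simp add: finite_points)
  have "\<exists>C\<in>(\<lambda>C. C \<union> T) ` \<C>. S \<subseteq> C" if S: "gen_pos S" "T \<subseteq> S" for S
  proof -
    have "S - T \<subseteq> P - T" using S by (auto simp: gen_pos_def)
    moreover have "\<forall>u\<in>S - T. \<forall>v\<in>S - T. \<not> linked T u v" using gen_pos_not_linked[OF S] by blast
    ultimately obtain C where "C \<in> \<C>" "S - T \<subseteq> C"
      using C(2)[rule_format, of "S - T"] by auto
    then show ?thesis by (intro bexI[of _ "C \<union> T"]) auto
  qed
  moreover have "(\<lambda>C. C \<union> T) ` \<C> \<subseteq> Pow P" using C(1) TP by auto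
  moreover have "\<forall>C\<in>(\<lambda>C. C \<union> T) ` \<C>. real (card C) \<le> m + real (card T)"
  proof clarify
    fix C assume "C \<in> \<C>"
    then have "real (card C) \<le> m" using C(3) by blast
    then show "real (card (C \<union> T)) \<le> m + real (card T)" using card_Un_le[of C T] by linarith
  qed
  moreover have "real (card ((\<lambda>C. C \<union> T) ` \<C>)) \<le> (real (card P) + 1) powr (1 + ?D * ln (real (card P)))"
  proof -
    have le: "card (P - T) \<le> card P" using finite_points by (intro card_mono) auto
    have "?L (real (card (P - T))) \<le> ?L (real (card P))"
      using le by (intro monoD[OF log_potential_mono[OF y0 D]]) auto
    \<comment> \<open>Since the slack \<open>?y\<close> is at least 1, dividing by it does not
      increase the argument of the logarithm, so the count no longer depends on
      \<open>m\<close>.\<close>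
    also have "\<dots> \<le> 1 + ?D * ln (real (card P))"
    proof (cases "real (card P) - ?Q \<le> ?y")
      case True
      then show ?thesis using D assms(5)
        by (auto simp: log_potential_def intro!: add_nonneg_nonneg mult_nonneg_nonneg)
    next
      case False
      have "(real (card P) - ?Q) / ?y \<le> (real (card P) - ?Q) / 1"
        using y False by (intro divide_left_mono) auto
      also have "\<dots> \<le> real (card P)" by simp
      finally have "ln ((real (card P) - ?Q) / ?y) \<le> ln (real (card P))"
        using False y by (intro ln_mono divide_pos_pos) auto
      then have "?D * ln ((real (card P) - ?Q) / ?y) \<le> ?D * ln (real (card P))"
        using D by (intro mult_left_mono) auto
      then show ?thesis using False by (simp add: log_potential_def)
    qed
    finally have L: "?L (real (card (P - T))) \<le> 1 + ?D * ln (real (card P))" .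
    have "real (card ((\<lambda>C. C \<union> T) ` \<C>)) \<le> real (card \<C>)" using card_image_le[OF finC] by simp
    also have "\<dots> \<le> real (card (P - T) + 1) powr ?L (real (card (P - T)))" by (rule C(4))
    also have "\<dots> \<le> (real (card P) + 1) powr ?L (real (card (P - T)))"
      using le log_potential_nonneg[OF y0 D] by (intro powr_mono2) auto
    also have "\<dots> \<le> (real (card P) + 1) powr (1 + ?D * ln (real (card P)))"
      using L by (intro powr_mono) auto
    finally show ?thesis .
  qed
  ultimately show ?thesis by (intro exI[of _ "(\<lambda>C. C \<union> T) ` \<C>"] conjI allI impI) auto
qed

text \<open>The families are united over all fingerprints \<open>T\<close> with at most s + d - 2
  points; the number of fingerprints adds s + d - 2 to the exponent. The size condition splits into
  the threshold \<open>q + 1\<close>, a slack of 1, and the points of the fingerprint.\<close>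

theorem gen_pos_containers:
  assumes "0 < s" and size: "real q + 2 + real (s + d - 2) \<le> M" and "1 \<le> card P"
  shows "\<exists>\<C>\<subseteq>Pow P. (\<forall>S. gen_pos S \<longrightarrow> (\<exists>C\<in>\<C>. S \<subseteq> C)) \<and>
    (\<forall>C\<in>\<C>. real (card C) \<le> M) \<and>
    real (card \<C>) \<le> (real (card P) + 1) powr
      (real (s + d - 2) + 1 + (real q + 1) * real (d * (d - 1)) / real s * ln (real (card P)))"
proof -
  let ?t = "s + d - 2"
  let ?\<T> = "{T. T \<subseteq> P \<and> card T \<le> ?t}"
  let ?e = "1 + (real q + 1) * real (d * (d - 1)) / real s * ln (real (card P))"
  have e: "0 \<le> ?e" using assms(3) by (intro add_nonneg_nonneg mult_nonneg_nonneg) auto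
  have fin: "finite ?\<T>" using finite_points by (auto intro: finite_subset[of _ "Pow P"])
  \<comment> \<open>Every \<open>T\<close> receives a family. Those that are too small or not in
    general position receive the default \<open>{T}\<close>, which covers a small \<open>T\<close>
    by itself and obeys the same bounds.\<close>
  have "\<forall>T\<in>?\<T>. \<exists>\<C>\<subseteq>Pow P. (gen_pos T \<longrightarrow> card T < ?t \<longrightarrow> T \<in> \<C>) \<and>
    (gen_pos T \<longrightarrow> card T = ?t \<longrightarrow> (\<forall>S. gen_pos S \<and> T \<subseteq> S \<longrightarrow> (\<exists>C\<in>\<C>. S \<subseteq> C))) \<and>
    (\<forall>C\<in>\<C>. real (card C) \<le> M) \<and> real (card \<C>) \<le> (real (card P) + 1) powr ?e"
    (is "\<forall>T\<in>?\<T>. \<exists>\<C>\<subseteq>Pow P. ?good T \<C>")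
  proof
    fix T assume T: "T \<in> ?\<T>"
    show "\<exists>\<C>\<subseteq>Pow P. ?good T \<C>"
    proof (cases "gen_pos T \<and> card T = ?t")
      case True
      then obtain \<C> where C: "\<C>\<subseteq>Pow P" "\<forall>S. gen_pos S \<and> T \<subseteq> S \<longrightarrow> (\<exists>C\<in>\<C>. S \<subseteq> C)"
        "\<forall>C\<in>\<C>. real (card C) \<le> M - real ?t + real (card T)"
        "real (card \<C>) \<le> (real (card P) + 1) powr ?e"
        using containers_over_fingerprint[of T s "M - real ?t"] assms by auto
      then show ?thesis using True by (intro exI[of _ \<C>]) auto
    next
      case False
      have "real (card T) \<le> M" using T size by auto
      moreover have "1 \<le> (real (card P) + 1) powr ?e" using e by (intro ge_one_powr_ge_zero) auto
      ultimately show ?thesis using False T by (intro exI[of _ "{T}"]) auto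
    qed
  qed
  from bchoice[OF this] obtain f where "\<forall>T\<in>?\<T>. f T \<subseteq> Pow P \<and> ?good T (f T)" by (elim exE)
  then have f: "f T \<subseteq> Pow P \<and> ?good T (f T)" if "T \<in> ?\<T>" for T
    using that by (rule bspec)
  have f_sub: "f T \<subseteq> Pow P" if "T \<in> ?\<T>" for T using f[OF that] by (elim conjE)
  have f_self: "T \<in> f T" if "T \<in> ?\<T>" "gen_pos T" "card T < ?t" for T
    using f[OF that(1)] that(2,3) by (elim conjE) (rule mp[OF mp])
  have f_cover: "\<forall>S. gen_pos S \<and> T \<subseteq> S \<longrightarrow> (\<exists>C\<in>f T. S \<subseteq> C)"
    if "T \<in> ?\<T>" "gen_pos T" "card T = ?t" for T
    using f[OF that(1)] that(2,3) by (elim conjE) (rule mp[OF mp])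
  have f_card: "\<forall>C\<in>f T. real (card C) \<le> M" if "T \<in> ?\<T>" for T using f[OF that] by (elim conjE)
  have f_count: "real (card (f T)) \<le> (real (card P) + 1) powr ?e" if "T \<in> ?\<T>" for T
    using f[OF that] by (elim conjE)
  let ?\<C> = "\<Union>T\<in>?\<T>. f T"
  have "\<exists>C\<in>?\<C>. S \<subseteq> C" if S: "gen_pos S" for S
  proof (cases "card S < ?t")
    case True
    then have "S \<in> ?\<T>" using S by (auto simp: gen_pos_def)
    then show ?thesis using f_self[OF _ S True] by (intro bexI[of _ S] UN_I[of S]) auto
  next
    case False
    then have "?t \<le> card S" by simp
    then obtain T where T: "T \<subseteq> S" "card T = ?t" by (rule obtain_subset_with_card_n)
    have gT: "gen_pos T" using S T(1) by (rule gen_pos_subset)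
    then have TT: "T \<in> ?\<T>" using T by (simp add: gen_pos_def)
    then obtain C where "C \<in> f T" "S \<subseteq> C"
      using f_cover[OF TT gT T(2), rule_format, of S] S T by auto
    then show ?thesis using TT by (intro bexI[of _ C] UN_I[of T]) auto
  qed
  moreover have "?\<C> \<subseteq> Pow P" using f_sub by (intro UN_least)
  moreover have "\<forall>C\<in>?\<C>. real (card C) \<le> M" using f_card by (intro ballI) (elim UN_E, blast)
  moreover have "real (card ?\<C>) \<le> (real (card P) + 1) powr (real ?t + 1 +
      (real q + 1) * real (d * (d - 1)) / real s * ln (real (card P)))"
  proof -
    have "real (card ?\<C>) \<le> real (\<Sum>T\<in>?\<T>. card (f T))"
      using card_UN_le[OF fin, of f] by (rule of_nat_mono)
    also have "\<dots> \<le> (\<Sum>T\<in>?\<T>. (real (card P) + 1) powr ?e)"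
      unfolding of_nat_sum using f_count by (intro sum_mono)
    also have "\<dots> = real (card ?\<T>) * (real (card P) + 1) powr ?e" by simp
    also have "\<dots> \<le> real ((card P + 1) ^ ?t) * (real (card P) + 1) powr ?e"
      using card_subsets_le[OF finite_points] by (intro mult_right_mono of_nat_mono) auto
    also have "\<dots> = (real (card P) + 1) powr real ?t * (real (card P) + 1) powr ?e"
      by (subst powr_realpow) (auto simp: add.commute)
    also have "\<dots> = (real (card P) + 1) powr (real ?t + ?e)" by (simp only: powr_add)
    finally show ?thesis by (simp add: add.assoc)
  qed
  ultimately show ?thesis by (intro exI[of _ ?\<C>] conjI allI impI)
qed

end

subsection \<open>Hyperplanes over a finite field\<close>

text \<open>A basis with b elements yields exactly |K|^b vectors, and |K| > 1 makes the exponent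
  unique. This gives the dimension of a subspace by counting, without exhibiting a basis.\<close>

lemma (in vectorspace) dim_eq_of_card:
  assumes "finite (carrier K)" "finite (carrier V)"
    and "card (carrier V) = card (carrier K) ^ n"
  shows "fin_dim" "dim = n"
proof -
  have "span (carrier V) = carrier V"
    using span_is_subset2[of "carrier V"] in_own_span[of "carrier V"] by blast
  then show fd: fin_dim using assms(2) unfolding fin_dim_def by blast
  then obtain \<beta> where \<beta>: "finite \<beta>" "basis \<beta>" using finite_basis_exists by blast
  then have sub: "\<beta> \<subseteq> carrier V" by (simp add: basis_def)
  have ex1: "\<exists>!a. a \<in> \<beta> \<rightarrow>\<^sub>E carrier K \<and> lincomb a \<beta> = v" if "v \<in> carrier V" for v
    using basis_criterion[OF \<beta>(1) sub] \<beta>(2) that by blast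
  have "bij_betw (\<lambda>a. lincomb a \<beta>) (\<beta> \<rightarrow>\<^sub>E carrier K) (carrier V)"
  proof (rule bij_betw_imageI)
    have closed: "lincomb a \<beta> \<in> carrier V" if "a \<in> \<beta> \<rightarrow>\<^sub>E carrier K" for a
      using that \<beta>(1) sub by (intro lincomb_closed) auto
    show "inj_on (\<lambda>a. lincomb a \<beta>) (\<beta> \<rightarrow>\<^sub>E carrier K)"
      using ex1 closed by (intro inj_onI) metis
    show "(\<lambda>a. lincomb a \<beta>) ` (\<beta> \<rightarrow>\<^sub>E carrier K) = carrier V"
    proof (intro equalityI subsetI)
      fix v assume "v \<in> carrier V"
      then show "v \<in> (\<lambda>a. lincomb a \<beta>) ` (\<beta> \<rightarrow>\<^sub>E carrier K)" using ex1[of v] by blast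
    qed (use closed in auto)
  qed
  then have "card (carrier V) = card (carrier K) ^ card \<beta>"
    using card_PiE[OF \<beta>(1), of "\<lambda>_. carrier K"] bij_betw_same_card by fastforce
  moreover have "1 < card (carrier K)"
  proof -
    have "{\<zero>\<^bsub>K\<^esub>, \<one>\<^bsub>K\<^esub>} \<subseteq> carrier K" by auto
    then have "card {\<zero>\<^bsub>K\<^esub>, \<one>\<^bsub>K\<^esub>} \<le> card (carrier K)" by (intro card_mono assms(1))
    then show ?thesis by (simp add: eq_commute[of "\<zero>\<^bsub>K\<^esub>"])
  qed
  ultimately have "card \<beta> = n" using assms(3) by (metis power_inject_exp)
  then show "dim = n" using dim_basis[OF \<beta>] by simp
qed

section \<open>Bilinear pairing over a commutative ring\<close>

definition (in ring) dot :: "'i set \<Rightarrow> ('i \<Rightarrow> 'a) \<Rightarrow> ('i \<Rightarrow> 'a) \<Rightarrow> 'a"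
  where "dot I a v = (\<Oplus>i\<in>I. a i \<otimes> v i)"

context cring
begin

lemma dot_closed: "a \<in> I \<rightarrow> carrier R \<Longrightarrow> v \<in> I \<rightarrow> carrier R \<Longrightarrow> dot I a v \<in> carrier R"
  unfolding dot_def by (intro finsum_closed) auto

lemma dot_cong:
  assumes "a' \<in> I \<rightarrow> carrier R" "v' \<in> I \<rightarrow> carrier R"
    and "\<And>i. i \<in> I \<Longrightarrow> a i = a' i" "\<And>i. i \<in> I \<Longrightarrow> v i = v' i"
  shows "dot I a v = dot I a' v'"
  unfolding dot_def using assms by (intro finsum_cong') auto

lemma dot_commute:
  assumes "a \<in> I \<rightarrow> carrier R" "v \<in> I \<rightarrow> carrier R"
  shows "dot I a v = dot I v a"
  unfolding dot_def using assms by (intro finsum_cong') (auto intro: m_comm)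

lemma dot_insert:
  assumes "finite I" "i \<notin> I" "a \<in> insert i I \<rightarrow> carrier R" "v \<in> insert i I \<rightarrow> carrier R"
  shows "dot (insert i I) a v = a i \<otimes> v i \<oplus> dot I a v"
  unfolding dot_def using assms by (intro finsum_insert) auto

lemma dot_add_smult:
  assumes "finite I" "a \<in> I \<rightarrow> carrier R" "b \<in> I \<rightarrow> carrier R" "v \<in> I \<rightarrow> carrier R" "c \<in> carrier R"
  shows "dot I (\<lambda>i. a i \<oplus> c \<otimes> b i) v = dot I a v \<oplus> c \<otimes> dot I b v"
proof -
  have "dot I (\<lambda>i. a i \<oplus> c \<otimes> b i) v = (\<Oplus>i\<in>I. a i \<otimes> v i \<oplus> c \<otimes> (b i \<otimes> v i))"
    unfolding dot_def using assms by (intro finsum_cong') (auto simp: Pi_iff l_distr m_assoc)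
  also have "\<dots> = (\<Oplus>i\<in>I. a i \<otimes> v i) \<oplus> (\<Oplus>i\<in>I. c \<otimes> (b i \<otimes> v i))"
    using assms by (intro finsum_addf) (auto simp: Pi_iff)
  also have "(\<Oplus>i\<in>I. c \<otimes> (b i \<otimes> v i)) = c \<otimes> (\<Oplus>i\<in>I. b i \<otimes> v i)"
    using assms by (intro finsum_rdistr[symmetric]) (auto simp: Pi_iff)
  finally show ?thesis by (simp add: dot_def)
qed

lemma dot_zero:
  assumes "\<And>i. i \<in> I \<Longrightarrow> a i \<otimes> v i = \<zero>"
  shows "dot I a v = \<zero>"
proof -
  have "dot I a v = (\<Oplus>i\<in>I. \<zero>)"
    unfolding dot_def using assms by (intro finsum_cong') auto
  then show ?thesis by simp
qed

lemma dot_single: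
  assumes "finite I" "j \<in> I" "a \<in> I \<rightarrow> carrier R" "v \<in> I \<rightarrow> carrier R"
    and "\<And>i. i \<in> I \<Longrightarrow> i \<noteq> j \<Longrightarrow> a i \<otimes> v i = \<zero>"
  shows "dot I a v = a j \<otimes> v j"
proof -
  have "insert j (I - {j}) = I" using assms(2) by blast
  then have "dot I a v = a j \<otimes> v j \<oplus> dot (I - {j}) a v"
    using dot_insert[of "I - {j}" j a v] assms(1,3,4) by simp
  moreover have "dot (I - {j}) a v = \<zero>" using assms(5) by (intro dot_zero) auto
  moreover have "a j \<otimes> v j \<in> carrier R" using assms(2,3,4) by auto
  ultimately show ?thesis by simp
qed

text \<open>A linear functional \<open>b\<close> commutes with linear combinations.
  \<open>dot\<close> plays two roles here: over \<open>I\<close> it pairs a functional with a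
  vector, over \<open>Y\<close> it forms a combination of the vectors \<open>V y\<close> with
  coefficients \<open>c\<close>.\<close>

lemma dot_dot_swap:
  assumes "finite Y" "finite I" "b \<in> I \<rightarrow> carrier R" "c \<in> Y \<rightarrow> carrier R"
    and "\<And>y. y \<in> Y \<Longrightarrow> V y \<in> I \<rightarrow> carrier R"
  shows "dot I b (\<lambda>i. dot Y c (\<lambda>y. V y i)) = dot Y c (\<lambda>y. dot I b (V y))"
  using assms(1,4,5)
proof (induction Y rule: finite_induct)
  case empty
  have "dot I b (\<lambda>i. dot {} c (\<lambda>y. V y i)) = \<zero>"
    using assms(3) by (intro dot_zero) (auto simp: dot_def Pi_iff)
  then show ?case by (simp add: dot_def)
next
  case (insert y Y)
  have c: "c y \<in> carrier R" "c \<in> Y \<rightarrow> carrier R" using insert.prems by auto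
  have V: "V y \<in> I \<rightarrow> carrier R" "\<And>y. y \<in> Y \<Longrightarrow> V y \<in> I \<rightarrow> carrier R" using insert.prems by auto
  have rest: "(\<lambda>i. dot Y c (\<lambda>y. V y i)) \<in> I \<rightarrow> carrier R"
    using c V by (intro Pi_I dot_closed) auto
  have dotV: "(\<lambda>y. dot I b (V y)) \<in> insert y Y \<rightarrow> carrier R"
    by (intro Pi_I dot_closed[OF assms(3) insert.prems(2)])
  have sum: "(\<lambda>i. dot Y c (\<lambda>y. V y i) \<oplus> c y \<otimes> V y i) \<in> I \<rightarrow> carrier R"
    using funcset_mem[OF rest] c V by (intro Pi_I a_closed m_closed) auto
  have "dot I b (\<lambda>i. dot (insert y Y) c (\<lambda>y. V y i))
      = dot I b (\<lambda>i. dot Y c (\<lambda>y. V y i) \<oplus> c y \<otimes> V y i)"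
  proof (rule dot_cong)
    fix i assume i: "i \<in> I"
    have "dot (insert y Y) c (\<lambda>y. V y i) = c y \<otimes> V y i \<oplus> dot Y c (\<lambda>y. V y i)"
      using insert.hyps c V i by (intro dot_insert) auto
    also have "\<dots> = dot Y c (\<lambda>y. V y i) \<oplus> c y \<otimes> V y i"
      using c V i rest by (intro a_comm) auto
    finally show "dot (insert y Y) c (\<lambda>y. V y i) = dot Y c (\<lambda>y. V y i) \<oplus> c y \<otimes> V y i" .
  qed (use assms(3) sum in auto)
  \<comment> \<open>\<open>dot_add_smult\<close> gives linearity in the first argument, hence the
    detour through commutativity.\<close>
  also have "\<dots> = dot I (\<lambda>i. dot Y c (\<lambda>y. V y i) \<oplus> c y \<otimes> V y i) b"
    using assms(3) sum by (intro dot_commute)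
  also have "\<dots> = dot I (\<lambda>i. dot Y c (\<lambda>y. V y i)) b \<oplus> c y \<otimes> dot I (V y) b"
    using assms(2,3) c V rest by (intro dot_add_smult)
  also have "\<dots> = dot I b (\<lambda>i. dot Y c (\<lambda>y. V y i)) \<oplus> c y \<otimes> dot I b (V y)"
    using assms(3) V rest dot_commute[of b I "V y"] dot_commute[of b I "\<lambda>i. dot Y c (\<lambda>y. V y i)"]
    by simp
  also have "dot I b (\<lambda>i. dot Y c (\<lambda>y. V y i)) = dot Y c (\<lambda>y. dot I b (V y))"
    using c V by (intro insert.IH)
  also have "\<dots> \<oplus> c y \<otimes> dot I b (V y) = c y \<otimes> dot I b (V y) \<oplus> dot Y c (\<lambda>y. dot I b (V y))"
    using c funcset_mem[OF dotV] by (intro a_comm m_closed dot_closed[of c Y]) auto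
  also have "\<dots> = dot (insert y Y) c (\<lambda>y. dot I b (V y))"
    using insert.hyps insert.prems(1) dotV by (intro dot_insert[symmetric])
  finally show ?case .
qed

end

section \<open>Affine points and linear functionals over a finite field\<close>

locale finite_affine_space = field F for F :: "nat ring" (structure) +
  fixes d :: nat
  assumes finite_carrier: "finite (carrier F)"
begin

definition points :: "(nat \<Rightarrow> nat) set"
  where "points = {..<d} \<rightarrow>\<^sub>E carrier F"

definition vectors :: "(nat \<Rightarrow> nat) set"
  where "vectors = {..d} \<rightarrow>\<^sub>E carrier F"

text \<open>Homogeneous coordinates: the entry with index \<open>d\<close> is \<open>1\<close>, so that affine functionals become
  linear ones.\<close>

definition lift :: "(nat \<Rightarrow> nat) \<Rightarrow> nat \<Rightarrow> nat"
  where "lift x = (\<lambda>i\<in>{..d}. if i < d then x i else \<one>)"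

text \<open>Functionals whose only nonzero entry has index \<open>d\<close> are included: they are
  nonzero constants on the affine points and have no zeros, so they describe the hyperplane at
  infinity.\<close>

definition functionals :: "(nat \<Rightarrow> nat) set"
  where "functionals = {a \<in> vectors. \<exists>i\<le>d. a i \<noteq> \<zero>}"

definition zeros :: "(nat \<Rightarrow> nat) \<Rightarrow> (nat \<Rightarrow> nat) set"
  where "zeros a = {x \<in> points. dot {..d} a (lift x) = \<zero>}"

lemma two_le_card_carrier: "2 \<le> card (carrier F)"
proof -
  have "card {\<zero>, \<one>} \<le> card (carrier F)" by (intro card_mono finite_carrier) auto
  then show ?thesis by (simp add: eq_commute[of "\<zero>"])
qed

lemma card_points: "card points = card (carrier F) ^ d"
  by (simp add: points_def card_PiE)

lemma card_vectors: "card vectors = card (carrier F) ^ (d + 1)"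
  by (simp add: vectors_def card_PiE)

lemma finite_points: "finite points"
  unfolding points_def by (intro finite_PiE finite_carrier) auto

lemma finite_vectors: "finite vectors"
  unfolding vectors_def by (intro finite_PiE finite_carrier) auto

lemma vectors_funcset: "a \<in> vectors \<Longrightarrow> a \<in> {..d} \<rightarrow> carrier F"
  by (auto simp: vectors_def)

lemma points_funcset: "x \<in> points \<Longrightarrow> x \<in> {..<d} \<rightarrow> carrier F"
  by (auto simp: points_def)

lemma lift_in_vectors: "x \<in> points \<Longrightarrow> lift x \<in> vectors"
  using points_funcset[of x] by (simp add: vectors_def lift_def restrict_PiE_iff Pi_iff)

lemma dot_vectors_closed: "a \<in> vectors \<Longrightarrow> v \<in> vectors \<Longrightarrow> dot {..d} a v \<in> carrier F"
  by (intro dot_closed vectors_funcset)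

lemma functionals_vectors: "a \<in> functionals \<Longrightarrow> a \<in> vectors"
  by (simp add: functionals_def)

lemma zerosD: "x \<in> zeros a \<Longrightarrow> dot {..d} a (lift x) = \<zero>"
  by (simp add: zeros_def)

lemma combination_in_vectors:
  assumes "a \<in> vectors" "b \<in> vectors" "c \<in> carrier F"
  shows "(\<lambda>i\<in>{..d}. a i \<oplus> c \<otimes> b i) \<in> vectors"
  using assms by (auto simp: vectors_def)

lemma dot_combination:
  assumes "a \<in> vectors" "b \<in> vectors" "c \<in> carrier F" "v \<in> vectors"
  shows "dot {..d} (\<lambda>i\<in>{..d}. a i \<oplus> c \<otimes> b i) v = dot {..d} a v \<oplus> c \<otimes> dot {..d} b v"
proof -
  note f = vectors_funcset[OF assms(1)] vectors_funcset[OF assms(2)] vectors_funcset[OF assms(4)]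
  have "dot {..d} (\<lambda>i\<in>{..d}. a i \<oplus> c \<otimes> b i) v = dot {..d} (\<lambda>i. a i \<oplus> c \<otimes> b i) v"
    using f assms(3) by (intro dot_cong) auto
  also have "\<dots> = dot {..d} a v \<oplus> c \<otimes> dot {..d} b v"
    using f assms(3) by (intro dot_add_smult) auto
  finally show ?thesis .
qed

lemma diff_eq_zero:
  assumes "x \<in> carrier F" "y \<in> carrier F"
  shows "x \<oplus> (\<ominus> \<one>) \<otimes> y = \<zero> \<longleftrightarrow> x = y"
proof -
  have "(\<ominus> \<one>) \<otimes> y = \<ominus> y" using assms by (simp add: l_minus)
  moreover have "x = y" if "x \<oplus> \<ominus> y = \<zero>" using sum_zero_eq_neg[OF _ _ that] assms by simp
  ultimately show ?thesis using assms by (auto simp: r_neg)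
qed

lemma exists_nonorthogonal:
  assumes "a \<in> functionals"
  shows "\<exists>v\<in>vectors. dot {..d} a v \<noteq> \<zero>"
proof -
  obtain j where j: "j \<le> d" "a j \<noteq> \<zero>" and a: "a \<in> vectors"
    using assms by (auto simp: functionals_def)
  let ?v = "\<lambda>i\<in>{..d}. if i = j then \<one> else \<zero>"
  have v: "?v \<in> vectors" by (auto simp: vectors_def)
  have "dot {..d} a ?v = a j \<otimes> ?v j"
    using j vectors_funcset[OF a] by (intro dot_single) (auto simp: Pi_iff)
  also have "\<dots> = a j" using j vectors_funcset[OF a] by (simp add: Pi_iff)
  finally show ?thesis using j v by (intro bexI[of _ ?v]) auto
qed

text \<open>Pigeonhole instead of rank: there are |F|^(d+1) vectors \<open>a\<close> but at most
  |F|^d value patterns on \<open>X\<close>, so two distinct vectors agree on \<open>X\<close>, and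
  their difference is the required functional.\<close>

lemma exists_annihilator:
  assumes "finite X" "X \<subseteq> vectors" "card X \<le> d"
  shows "\<exists>a\<in>functionals. \<forall>v\<in>X. dot {..d} a v = \<zero>"
proof -
  let ?f = "\<lambda>a. \<lambda>v\<in>X. dot {..d} a v"
  have q: "1 < card (carrier F)" using two_le_card_carrier by simp
  have "card (?f ` vectors) \<le> card (X \<rightarrow>\<^sub>E carrier F)"
    using assms by (intro card_mono finite_PiE finite_carrier) (auto intro!: dot_vectors_closed)
  also have "\<dots> = card (carrier F) ^ card X" using assms(1) by (simp add: card_PiE)
  also have "\<dots> < card (carrier F) ^ (d + 1)"
    using assms(3) q by (intro power_strict_increasing) auto
  also have "\<dots> = card vectors" by (simp add: card_vectors)
  finally have "\<not> inj_on ?f vectors" by (intro pigeonhole)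
  then obtain a b where ab: "a \<in> vectors" "b \<in> vectors" "a \<noteq> b" "?f a = ?f b"
    unfolding inj_on_def by blast
  let ?c = "\<lambda>i\<in>{..d}. a i \<oplus> (\<ominus> \<one>) \<otimes> b i"
  have c: "?c \<in> vectors" using ab by (intro combination_in_vectors) auto
  obtain i where i: "i \<le> d" "a i \<noteq> b i"
    using ab unfolding vectors_def by (metis PiE_ext atMost_iff)
  have "?c i \<noteq> \<zero>" using i diff_eq_zero[of "a i" "b i"] ab(1,2)[THEN vectors_funcset] by auto
  then have "?c \<in> functionals" using c i unfolding functionals_def by blast
  moreover have "dot {..d} ?c v = \<zero>" if v: "v \<in> X" for v
  proof -
    have "dot {..d} a v = dot {..d} b v" using fun_cong[OF ab(4), of v] v by simp
    then show ?thesis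
      using dot_combination[OF ab(1,2), of "\<ominus> \<one>" v] v assms(2) ab(1,2)
        diff_eq_zero[of "dot {..d} b v" "dot {..d} b v"] dot_vectors_closed[of b v]
      by auto
  qed
  ultimately show ?thesis by blast
qed

text \<open>Pigeonhole again: there are |F|^(d+1) coefficient families, while all combinations lie
  in the kernel of \<open>a\<close>, which is a proper subset of \<open>vectors\<close>. The vectors
  are indexed by \<open>Y\<close>, so the dependence is stated directly for points.\<close>

lemma exists_dependence:
  assumes "finite Y" "card Y = d + 1" "\<And>y. y \<in> Y \<Longrightarrow> V y \<in> vectors"
    and a: "a \<in> functionals" "\<And>y. y \<in> Y \<Longrightarrow> dot {..d} a (V y) = \<zero>"
  shows "\<exists>c\<in>Y \<rightarrow> carrier F. (\<exists>y\<in>Y. c y \<noteq> \<zero>) \<and> (\<forall>i\<le>d. dot Y c (\<lambda>y. V y i) = \<zero>)"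
proof -
  let ?f = "\<lambda>c. \<lambda>i\<in>{..d}. dot Y c (\<lambda>y. V y i)"
  let ?K = "{v \<in> vectors. dot {..d} a v = \<zero>}"
  have V: "V y i \<in> carrier F" if "y \<in> Y" "i \<le> d" for y i
    using vectors_funcset[OF assms(3)[OF that(1)]] that(2) by auto
  have f: "?f c \<in> ?K" if c: "c \<in> Y \<rightarrow>\<^sub>E carrier F" for c
  proof -
    have cl: "dot Y c (\<lambda>y. V y i) \<in> carrier F" if "i \<le> d" for i
      using c V that by (intro dot_closed) auto
    have "dot {..d} a (?f c) = dot {..d} a (\<lambda>i. dot Y c (\<lambda>y. V y i))"
      using cl vectors_funcset[OF functionals_vectors[OF a(1)]] by (intro dot_cong) auto
    also have "\<dots> = dot Y c (\<lambda>y. dot {..d} a (V y))"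
      using assms(1) c V vectors_funcset[OF functionals_vectors[OF a(1)]]
      by (intro dot_dot_swap) auto
    also have "\<dots> = \<zero>" using a(2) PiE_mem[OF c] by (intro dot_zero) simp
    finally show ?thesis using cl by (auto simp: vectors_def)
  qed
  have "?K \<subset> vectors" using exists_nonorthogonal[OF a(1)] by auto
  then have "card ?K < card vectors" by (intro psubset_card_mono finite_vectors)
  moreover have "card (?f ` (Y \<rightarrow>\<^sub>E carrier F)) \<le> card ?K"
    using f finite_vectors by (intro card_mono) auto
  moreover have "card (Y \<rightarrow>\<^sub>E carrier F) = card vectors"
    using assms(1,2) by (simp add: card_PiE card_vectors)
  ultimately have "\<not> inj_on ?f (Y \<rightarrow>\<^sub>E carrier F)" by (intro pigeonhole) simp
  then obtain c c' where cc: "c \<in> Y \<rightarrow>\<^sub>E carrier F" "c' \<in> Y \<rightarrow>\<^sub>E carrier F" "c \<noteq> c'" "?f c = ?f c'"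
    unfolding inj_on_def by blast
  let ?e = "\<lambda>y. c y \<oplus> (\<ominus> \<one>) \<otimes> c' y"
  obtain y where y: "y \<in> Y" "c y \<noteq> c' y" using cc by (metis PiE_ext)
  have "?e y \<noteq> \<zero>" using y diff_eq_zero[of "c y" "c' y"] cc(1,2) by auto
  moreover have "?e \<in> Y \<rightarrow> carrier F" using cc by auto
  moreover have "dot Y ?e (\<lambda>y. V y i) = \<zero>" if i: "i \<le> d" for i
  proof -
    have funs: "c \<in> Y \<rightarrow> carrier F" "c' \<in> Y \<rightarrow> carrier F" "(\<lambda>y. V y i) \<in> Y \<rightarrow> carrier F"
      using cc V i by auto
    have "dot Y ?e (\<lambda>y. V y i) = dot Y c (\<lambda>y. V y i) \<oplus> (\<ominus> \<one>) \<otimes> dot Y c' (\<lambda>y. V y i)"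
      using funs assms(1) by (intro dot_add_smult) auto
    moreover have "dot Y c (\<lambda>y. V y i) = dot Y c' (\<lambda>y. V y i)"
      using fun_cong[OF cc(4), of i] i by simp
    moreover have "dot Y c' (\<lambda>y. V y i) \<in> carrier F" using funs by (intro dot_closed)
    ultimately show ?thesis using diff_eq_zero by simp
  qed
  ultimately show ?thesis using y(1) by (intro bexI[of _ ?e]) blast+
qed

section \<open>Incidence properties of zero sets\<close>

lemma through_points:
  assumes "X \<subseteq> points" "card X \<le> d"
  shows "\<exists>H\<in>zeros ` functionals. X \<subseteq> H"
proof -
  have fin: "finite X" using assms(1) finite_points by (rule finite_subset)
  have "card (lift ` X) \<le> d" using card_image_le[OF fin, of lift] assms(2) by simp
  then obtain a where "a \<in> functionals" "\<forall>v\<in>lift ` X. dot {..d} a v = \<zero>"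
    using exists_annihilator[of "lift ` X"] fin assms(1) lift_in_vectors by blast
  then show ?thesis using assms(1) by (intro bexI[of _ "zeros a"]) (auto simp: zeros_def)
qed

text \<open>Two independent functionals \<open>f\<close> and \<open>g\<close> that vanish on
  \<open>R\<close> span the pencil: its members are \<open>g\<close> and f + c g for c in F, at most
  |F| + 1 zero sets in all. A point \<open>x\<close> goes to \<open>g\<close> if g(x) = 0 and
  otherwise to the member with c = -f(x)/g(x).\<close>

lemma pencil:
  assumes "2 \<le> d" "R \<subseteq> points" "card R = d - 1"
  shows "\<exists>h. h ` points \<subseteq> zeros ` functionals \<and> card (h ` points) \<le> card (carrier F) + 1 \<and>
    (\<forall>x\<in>points. insert x R \<subseteq> h x)"
proof -
  have finR: "finite R" using assms(2) finite_points by (rule finite_subset)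
  have card_lift: "card (lift ` R) \<le> d - 1" using card_image_le[OF finR, of lift] assms(3) by simp
  have liftR: "lift ` R \<subseteq> vectors" using assms(2) lift_in_vectors by blast
  have "card (lift ` R) \<le> d" using card_lift by linarith
  then obtain f where f: "f \<in> functionals" "\<forall>v\<in>lift ` R. dot {..d} f v = \<zero>"
    using exists_annihilator[of "lift ` R"] finR liftR by blast
  \<comment> \<open>The witness for independence: \<open>g\<close> will vanish at \<open>p\<close>
    while \<open>f\<close> does not, so f + c g is nonzero for every c. Adding \<open>p\<close> to
    the d - 1 points of \<open>R\<close> still leaves at most \<open>d\<close> conditions on
    \<open>g\<close>.\<close>
  obtain p where p: "p \<in> vectors" "dot {..d} f p \<noteq> \<zero>" using exists_nonorthogonal[OF f(1)] by blast
  have "card (insert p (lift ` R)) \<le> Suc (card (lift ` R))" by (rule card_insert_le_m1) (use finR in auto)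
  then have "card (insert p (lift ` R)) \<le> d" using card_lift assms(1) by simp
  then obtain g where g: "g \<in> functionals" "\<forall>v\<in>insert p (lift ` R). dot {..d} g v = \<zero>"
    using exists_annihilator[of "insert p (lift ` R)"] finR liftR p(1) by auto
  have fv: "f \<in> vectors" and gv: "g \<in> vectors" using f(1) g(1) functionals_vectors by auto
  let ?k = "\<lambda>c. \<lambda>i\<in>{..d}. f i \<oplus> c \<otimes> g i"
  have dot_k: "dot {..d} (?k c) v = dot {..d} f v \<oplus> c \<otimes> dot {..d} g v"
    if "c \<in> carrier F" "v \<in> vectors" for c v
    using dot_combination[OF fv gv that] .
  have k: "?k c \<in> functionals" if c: "c \<in> carrier F" for c
  proof -
    have kv: "?k c \<in> vectors" using combination_in_vectors[OF fv gv c] .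
    have "dot {..d} (?k c) p \<noteq> \<zero>"
      using dot_k[OF c p(1)] g(2) p c dot_vectors_closed[OF fv p(1)] by simp
    moreover have "dot {..d} (?k c) p = \<zero>" if "\<forall>i\<le>d. ?k c i = \<zero>"
      using that vectors_funcset[OF p(1)] by (intro dot_zero) (simp add: Pi_iff)
    ultimately have "\<exists>i\<le>d. ?k c i \<noteq> \<zero>" by blast
    with kv show ?thesis unfolding functionals_def by (intro CollectI conjI)
  qed
  let ?c = "\<lambda>x. \<ominus> (dot {..d} f (lift x) \<otimes> inv (dot {..d} g (lift x)))"
  let ?h = "\<lambda>x. if dot {..d} g (lift x) = \<zero> then zeros g else zeros (?k (?c x))"
  have c: "?c x \<in> carrier F" and ck: "dot {..d} f (lift x) \<oplus> ?c x \<otimes> dot {..d} g (lift x) = \<zero>"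
    if x: "x \<in> points" "dot {..d} g (lift x) \<noteq> \<zero>" for x
  proof -
    let ?\<phi> = "dot {..d} f (lift x)" and ?\<gamma> = "dot {..d} g (lift x)"
    have cl: "?\<phi> \<in> carrier F" "?\<gamma> \<in> carrier F"
      by (rule dot_vectors_closed[OF fv lift_in_vectors[OF x(1)]],
          rule dot_vectors_closed[OF gv lift_in_vectors[OF x(1)]])
    then have u: "?\<gamma> \<in> Units F" using x(2) by (simp add: field_Units)
    then show "?c x \<in> carrier F" using cl by simp
    have "?c x \<otimes> ?\<gamma> = \<ominus> (?\<phi> \<otimes> (inv ?\<gamma> \<otimes> ?\<gamma>))" using cl u by (simp add: l_minus m_assoc)
    also have "\<dots> = \<ominus> ?\<phi>" using cl u by simp
    finally show "?\<phi> \<oplus> ?c x \<otimes> ?\<gamma> = \<zero>" using cl by (simp add: r_neg)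
  qed
  have "?h ` points \<subseteq> insert (zeros g) ((\<lambda>c. zeros (?k c)) ` carrier F)"
    using c by auto
  then have "card (?h ` points) \<le> card (insert (zeros g) ((\<lambda>c. zeros (?k c)) ` carrier F))"
    using finite_carrier by (intro card_mono) auto
  also have "\<dots> \<le> Suc (card ((\<lambda>c. zeros (?k c)) ` carrier F))"
    using finite_carrier by (intro card_insert_le_m1) auto
  also have "\<dots> \<le> card (carrier F) + 1" using card_image_le[OF finite_carrier] by simp
  finally have "card (?h ` points) \<le> card (carrier F) + 1" .
  moreover have "?h ` points \<subseteq> zeros ` functionals" using c k g(1) by auto
  moreover have "insert x R \<subseteq> ?h x" if x: "x \<in> points" for x
  proof (cases "dot {..d} g (lift x) = \<zero>")
    case True
    then show ?thesis using x assms(2) g(2) by (auto simp: zeros_def)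
  next
    case False
    have "dot {..d} (?k (?c x)) (lift r) = \<zero>" if "r \<in> R" for r
    proof -
      have "lift r \<in> vectors" using that assms(2) lift_in_vectors by blast
      then show ?thesis
        using dot_k[OF c[OF x False], of "lift r"] f(2) g(2) that c[OF x False] by simp
    qed
    moreover have "dot {..d} (?k (?c x)) (lift x) = \<zero>"
      using dot_k[OF c[OF x False] lift_in_vectors[OF x]] ck[OF x False] by simp
    ultimately have "insert x R \<subseteq> zeros (?k (?c x))" using x assms(2) by (auto simp: zeros_def)
    then show ?thesis using False by simp
  qed
  ultimately show ?thesis by (intro exI[of _ ?h] conjI ballI)
qed

text \<open>The \<open>d + 1\<close> lifted points are linearly dependent because they lie on
  \<open>H\<close>. The dependence has a nonzero coefficient at some \<open>r\<close> in
  \<open>R\<close>, since the lifts of the distinct points \<open>u\<close> and \<open>w\<close>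
  alone are independent; a functional vanishing at the other points then vanishes at
  \<open>r\<close>.\<close>

lemma exchange:
  assumes "2 \<le> d" "R \<subseteq> points" "card R = d - 1" and u: "u \<in> points - R" and w: "w \<in> points - R"
    and "u \<noteq> w" and H: "H \<in> zeros ` functionals" "insert u (insert w R) \<subseteq> H"
  shows "\<exists>r\<in>R. \<forall>H'\<in>zeros ` functionals. insert u (insert w (R - {r})) \<subseteq> H' \<longrightarrow> r \<in> H'"
proof -
  let ?Y = "insert u (insert w R)"
  have finR: "finite R" using assms(2) finite_points by (rule finite_subset)
  have Y: "finite ?Y" "card ?Y = d + 1" using finR assms(1,3) u w \<open>u \<noteq> w\<close> by auto
  have Yp: "y \<in> points" if "y \<in> ?Y" for y using that assms(2) u w by auto
  have lift: "lift y i \<in> carrier F" if "y \<in> ?Y" "i \<le> d" for y i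
    using vectors_funcset[OF lift_in_vectors[OF Yp[OF that(1)]]] that(2) by auto
  obtain a where a: "a \<in> functionals" "H = zeros a" using H(1) by blast
  have aY: "dot {..d} a (lift y) = \<zero>" if "y \<in> ?Y" for y
    using that H(2) a(2) by (intro zerosD) auto
  have "\<exists>c\<in>?Y \<rightarrow> carrier F. (\<exists>y\<in>?Y. c y \<noteq> \<zero>) \<and> (\<forall>i\<le>d. dot ?Y c (\<lambda>y. lift y i) = \<zero>)"
  proof (rule exists_dependence[OF Y _ a(1)])
    fix y assume "y \<in> ?Y"
    then show "lift y \<in> vectors" "dot {..d} a (lift y) = \<zero>"
      using lift_in_vectors[OF Yp] aY by auto
  qed
  then obtain c y0 where c: "c \<in> ?Y \<rightarrow> carrier F" and cy: "y0 \<in> ?Y" "c y0 \<noteq> \<zero>"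
    and dep: "\<forall>i\<le>d. dot ?Y c (\<lambda>y. lift y i) = \<zero>"
    by (elim bexE conjE)
  have cc: "c u \<in> carrier F" "c w \<in> carrier F" using c by auto
  have "\<exists>r\<in>R. c r \<noteq> \<zero>"
  proof (rule ccontr)
    assume "\<not> ?thesis"
    then have R0: "c r = \<zero>" if "r \<in> R" for r using that by blast
    have sum2: "c u \<otimes> lift u i \<oplus> c w \<otimes> lift w i = \<zero>" if i: "i \<le> d" for i
    proof -
      have "dot R c (\<lambda>y. lift y i) = \<zero>" using R0 lift i by (intro dot_zero) auto
      moreover have "dot (insert w R) c (\<lambda>y. lift y i) = c w \<otimes> lift w i \<oplus> dot R c (\<lambda>y. lift y i)"
        using finR w c lift i by (intro dot_insert) auto
      moreover have "dot ?Y c (\<lambda>y. lift y i) = c u \<otimes> lift u i \<oplus> dot (insert w R) c (\<lambda>y. lift y i)"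
        using finR u \<open>u \<noteq> w\<close> c lift i by (intro dot_insert) auto
      ultimately show ?thesis using dep[rule_format, OF i] cc lift[of w i] i by simp
    qed
    \<comment> \<open>Coordinate \<open>d\<close> of every lift is 1, so this coordinate relates the
      two coefficients; the other coordinates then force \<open>u\<close> and \<open>w\<close> to
      agree.\<close>
    have "c u \<oplus> c w = \<zero>" using sum2[of d] cc by (simp add: lift_def)
    then have cw: "c w = \<ominus> c u" using cc by (metis minus_equality a_comm minus_minus)
    have cu: "c u \<noteq> \<zero>" using cy R0 cw by auto
    have "u i = w i" if i: "i < d" for i
    proof -
      have ui: "u i \<in> carrier F" "w i \<in> carrier F"
        using points_funcset[OF Yp, of u] points_funcset[OF Yp, of w] i by auto
      have "c u \<otimes> u i = \<ominus> (\<ominus> c u \<otimes> w i)"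
        using sum2[of i] i ui cc cw by (simp add: lift_def) (metis cc(1) a_inv_closed m_closed minus_equality)
      also have "\<dots> = c u \<otimes> w i" using ui cc by (simp add: l_minus)
      finally show ?thesis using m_lcancel[OF cu cc(1) ui] by simp
    qed
    then have "u = w" using u w unfolding points_def by (intro PiE_ext[of u "{..<d}" _ w]) auto
    then show False using \<open>u \<noteq> w\<close> by blast
  qed
  then obtain r where r: "r \<in> R" "c r \<noteq> \<zero>" by blast
  have "r \<in> zeros b" if b: "b \<in> functionals" "insert u (insert w (R - {r})) \<subseteq> zeros b" for b
  proof -
    note bf = vectors_funcset[OF functionals_vectors[OF b(1)]]
    have bl: "dot {..d} b (lift y) \<in> carrier F" if "y \<in> ?Y" for y
      using dot_vectors_closed[OF functionals_vectors[OF b(1)] lift_in_vectors[OF Yp[OF that]]] .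
    \<comment> \<open>Applying \<open>b\<close> to the dependence leaves only the term at
      \<open>r\<close>.\<close>
    have "\<zero> = dot {..d} b (\<lambda>i. dot ?Y c (\<lambda>y. lift y i))"
      using dep bf by (intro dot_zero[symmetric]) (simp add: Pi_iff)
    also have "\<dots> = dot ?Y c (\<lambda>y. dot {..d} b (lift y))"
      using Y(1) bf c lift by (intro dot_dot_swap) auto
    also have "\<dots> = c r \<otimes> dot {..d} b (lift r)"
    proof (rule dot_single[OF Y(1) _ c])
      show "r \<in> ?Y" using r(1) by simp
      show "(\<lambda>y. dot {..d} b (lift y)) \<in> ?Y \<rightarrow> carrier F" using bl by (rule Pi_I)
    next
      fix y assume y: "y \<in> ?Y" "y \<noteq> r"
      then have "y \<in> zeros b" using b(2) by auto
      then show "c y \<otimes> dot {..d} b (lift y) = \<zero>"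
        using zerosD[of y b] funcset_mem[OF c y(1)] by simp
    qed
    finally have "c r \<otimes> dot {..d} b (lift r) = \<zero>" by simp
    moreover have "c r \<in> carrier F" "dot {..d} b (lift r) \<in> carrier F" using funcset_mem[OF c] bl r(1) by auto
    ultimately have "dot {..d} b (lift r) = \<zero>" using r(2) integral_iff by simp
    then show ?thesis using r(1) assms(2) by (auto simp: zeros_def)
  qed
  then show ?thesis using r(1) by (intro bexI[OF _ r(1)] ballI impI) (elim imageE, simp)
qed

end

section \<open>Zero sets as affine subspaces of dimension d - 1\<close>

context finite_affine_space
begin

lemma carrier_coord_space: "carrier (coord_space F d) = points"
  by (simp add: func_space_def points_def)

lemma dot_lift:
  assumes "a \<in> vectors" "x \<in> points"
  shows "dot {..d} a (lift x) = a d \<oplus> dot {..<d} a x"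
proof -
  note fa = vectors_funcset[OF assms(1)] and fl = vectors_funcset[OF lift_in_vectors[OF assms(2)]]
  have I: "insert d {..<d} = {..d}" by auto
  have "dot {..d} a (lift x) = a d \<otimes> lift x d \<oplus> dot {..<d} a (lift x)"
    using dot_insert[of "{..<d}" d a "lift x"] fa fl unfolding I by simp
  also have "dot {..<d} a (lift x) = dot {..<d} a x"
    using fa points_funcset[OF assms(2)] by (intro dot_cong) (auto simp: lift_def Pi_iff)
  also have "a d \<otimes> lift x d = a d" using fa by (simp add: lift_def Pi_iff)
  finally show ?thesis .
qed

text \<open>Because \<open>a j\<close> is invertible, coordinate \<open>j\<close> of a kernel vector
  is determined by the others, which are free. Forgetting it is a bijection onto the functions on d
  - 1 coordinates.\<close>

lemma card_linear_kernel:
  assumes a: "a \<in> {..<d} \<rightarrow> carrier F" and j: "j < d" "a j \<noteq> \<zero>"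
  shows "card {w \<in> points. dot {..<d} a w = \<zero>} = card (carrier F) ^ (d - 1)"
proof -
  let ?W = "{w \<in> points. dot {..<d} a w = \<zero>}" and ?I = "{..<d} - {j}"
  have aI: "a \<in> ?I \<rightarrow> carrier F" and aj: "a j \<in> carrier F" using a j(1) by auto
  have I: "insert j ?I = {..<d}" using j(1) by auto
  have split: "dot {..<d} a w = a j \<otimes> w j \<oplus> dot ?I a w" if "w \<in> {..<d} \<rightarrow> carrier F" for w
    using dot_insert[of ?I j a w] a that unfolding I by simp
  have "bij_betw (\<lambda>w. restrict w ?I) ?W (?I \<rightarrow>\<^sub>E carrier F)"
  proof (rule bij_betw_imageI)
    show "inj_on (\<lambda>w. restrict w ?I) ?W"
    proof (rule inj_onI)
      fix w w' assume w: "w \<in> ?W" "w' \<in> ?W" and eq: "restrict w ?I = restrict w' ?I"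
      have f: "w \<in> {..<d} \<rightarrow> carrier F" "w' \<in> {..<d} \<rightarrow> carrier F" using w points_funcset by auto
      have wI: "w i = w' i" if "i \<in> ?I" for i using fun_cong[OF eq, of i] that by simp
      have wj: "w j \<in> carrier F" "w' j \<in> carrier F" using f j(1) by auto
      have rest: "dot ?I a w \<in> carrier F" using aI f(1) by (intro dot_closed) auto
      have "dot ?I a w' = dot ?I a w" using aI f wI by (intro dot_cong) auto
      then have "a j \<otimes> w j \<oplus> dot ?I a w = \<zero>" "a j \<otimes> w' j \<oplus> dot ?I a w = \<zero>"
        using w split[OF f(1)] split[OF f(2)] by auto
      then have "a j \<otimes> w j = a j \<otimes> w' j"
        using sum_zero_eq_neg[OF _ rest, of "a j \<otimes> w j"] sum_zero_eq_neg[OF _ rest, of "a j \<otimes> w' j"]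
          aj wj by simp
      then have "w j = w' j" using m_lcancel[OF j(2) aj wj] by simp
      then have "w i = w' i" if "i \<in> {..<d}" for i using wI that by (cases "i = j") auto
      moreover have "w \<in> {..<d} \<rightarrow>\<^sub>E carrier F" "w' \<in> {..<d} \<rightarrow>\<^sub>E carrier F"
        using w by (simp_all add: points_def)
      ultimately show "w = w'" by (intro PiE_ext)
    qed
    show "(\<lambda>w. restrict w ?I) ` ?W = ?I \<rightarrow>\<^sub>E carrier F"
    proof (intro equalityI subsetI)
      fix f assume "f \<in> (\<lambda>w. restrict w ?I) ` ?W"
      then obtain w where "w \<in> points" "f = restrict w ?I" by blast
      then show "f \<in> ?I \<rightarrow>\<^sub>E carrier F" using points_funcset[of w] by auto
    next
      fix f assume f: "f \<in> ?I \<rightarrow>\<^sub>E carrier F"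
      then have fI: "f \<in> ?I \<rightarrow> carrier F" by auto
      have rest: "dot ?I a f \<in> carrier F" using aI fI by (rule dot_closed)
      have u: "a j \<in> Units F" using aj j(2) by (simp add: field_Units)
      let ?w = "\<lambda>i\<in>{..<d}. if i = j then \<ominus> (inv (a j) \<otimes> dot ?I a f) else f i"
      have wf: "?w \<in> {..<d} \<rightarrow> carrier F" using fI rest u by (simp add: Pi_iff)
      have "?w \<in> points" using wf unfolding points_def by (simp add: restrict_PiE_iff Pi_iff)
      moreover have "dot {..<d} a ?w = \<zero>"
      proof -
        have "dot ?I a ?w = dot ?I a f" using aI fI by (intro dot_cong) auto
        moreover have "a j \<otimes> ?w j = \<ominus> (a j \<otimes> inv (a j) \<otimes> dot ?I a f)"
          using j(1) aj u rest by (simp add: r_minus flip: m_assoc)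
        then have "a j \<otimes> ?w j = \<ominus> dot ?I a f" using u rest by simp
        ultimately show ?thesis using split[OF wf] rest by (simp add: l_neg)
      qed
      moreover have "restrict ?w ?I = f"
      proof (rule PiE_ext[OF _ f])
        show "restrict ?w ?I \<in> ?I \<rightarrow>\<^sub>E carrier F"
          using funcset_mem[OF wf] unfolding restrict_PiE_iff by blast
      qed simp
      ultimately show "f \<in> (\<lambda>w. restrict w ?I) ` ?W"
        by (intro image_eqI[of f _ ?w] CollectI conjI) simp_all
    qed
  qed
  then have "card ?W = card (?I \<rightarrow>\<^sub>E carrier F)" by (rule bij_betw_same_card)
  also have "\<dots> = card (carrier F) ^ (d - 1)" using j(1) by (simp add: card_PiE)
  finally show ?thesis .
qed

text \<open>The zero set is the translate by \<open>p\<close> of the kernel of the linear part of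
  \<open>a\<close>. The point \<open>p\<close> rules out the hyperplane at infinity, whose zero set
  is empty.\<close>

lemma hyperplane_zeros:
  assumes a: "a \<in> functionals" and p: "p \<in> zeros a"
  shows "hyperplane F d (zeros a)"
proof -
  let ?V = "coord_space F d"
  let ?W = "{w \<in> points. dot {..<d} a w = \<zero>}"
  note av = functionals_vectors[OF a]
  have ad: "a d \<in> carrier F" and af: "a \<in> {..<d} \<rightarrow> carrier F"
    using vectors_funcset[OF av] by (auto simp: Pi_iff)
  have pp: "p \<in> points" using p by (simp add: zeros_def)
  have fV: "field F" by (rule field_axioms)
  have mV: "Module.module F ?V" by (rule func_space_is_module)
  interpret V: vectorspace F ?V
    using mV fV by (rule vectorspace.intro)
  have dotp: "dot {..<d} a x \<in> carrier F" if "x \<in> points" for x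
    using af points_funcset[OF that] by (rule dot_closed)
  \<comment> \<open>If the linear part were zero, evaluation at \<open>p\<close> would give
    \<open>a d = \<zero>\<close> as well, and \<open>a\<close> would not be a functional.\<close>
  have \<open>\<exists>j<d. a j \<noteq> \<zero>\<close>
  proof (rule ccontr)
    assume "\<not> ?thesis"
    then have a0: "\<And>j. j < d \<Longrightarrow> a j = \<zero>" by blast
    then have "dot {..<d} a p = \<zero>" using points_funcset[OF pp] by (intro dot_zero) (simp add: Pi_iff)
    then have "a d = \<zero>" using zerosD[OF p] dot_lift[OF av pp] ad by simp
    then have "\<forall>i\<le>d. a i = \<zero>" using a0 le_neq_implies_less by blast
    then show False using a by (auto simp: functionals_def)
  qed
  then obtain j where j: "j < d" "a j \<noteq> \<zero>" by blast
  have addV: "x \<oplus>\<^bsub>?V\<^esub> y = (\<lambda>i\<in>{..<d}. x i \<oplus> y i)" for x y by (simp add: func_space_def)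
  have smV: "c \<odot>\<^bsub>?V\<^esub> x = (\<lambda>i\<in>{..<d}. c \<otimes> x i)" for c x by (simp add: func_space_def)
  have zeroV: "\<zero>\<^bsub>?V\<^esub> = (\<lambda>i\<in>{..<d}. \<zero>)" by (simp add: func_space_def)
  have add_points: "(\<lambda>i\<in>{..<d}. x i \<oplus> y i) \<in> points" if "x \<in> points" "y \<in> points" for x y
    using points_funcset[OF that(1)] points_funcset[OF that(2)]
    unfolding points_def by (simp add: restrict_PiE_iff Pi_iff)
  have smult_points: "(\<lambda>i\<in>{..<d}. c \<otimes> x i) \<in> points" if "c \<in> carrier F" "x \<in> points" for c x
    using points_funcset[OF that(2)] that(1)
    unfolding points_def by (simp add: restrict_PiE_iff Pi_iff)
  \<comment> \<open>One computation serves twice: c = 1 gives additivity and x = 0 gives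
    homogeneity.\<close>
  have dot_axpy: "dot {..<d} a (\<lambda>i\<in>{..<d}. x i \<oplus> c \<otimes> y i) = dot {..<d} a x \<oplus> c \<otimes> dot {..<d} a y"
    if "x \<in> points" "y \<in> points" "c \<in> carrier F" for x y c
  proof -
    note xy = points_funcset[OF that(1)] points_funcset[OF that(2)]
    have s: "(\<lambda>i. x i \<oplus> c \<otimes> y i) \<in> {..<d} \<rightarrow> carrier F" using xy that(3) by (simp add: Pi_iff)
    have "dot {..<d} a (\<lambda>i\<in>{..<d}. x i \<oplus> c \<otimes> y i) = dot {..<d} a (\<lambda>i. x i \<oplus> c \<otimes> y i)"
      using af s by (intro dot_cong) auto
    also have "\<dots> = dot {..<d} (\<lambda>i. x i \<oplus> c \<otimes> y i) a" using af s by (rule dot_commute)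
    also have "\<dots> = dot {..<d} x a \<oplus> c \<otimes> dot {..<d} y a"
      using xy af that(3) by (intro dot_add_smult) auto
    finally show ?thesis using dot_commute[OF af xy(1)] dot_commute[OF af xy(2)] by simp
  qed
  have restrict_one: "(\<lambda>i\<in>{..<d}. x i \<oplus> \<one> \<otimes> y i) = (\<lambda>i\<in>{..<d}. x i \<oplus> y i)" if "y \<in> points" for x y
    using points_funcset[OF that] by (intro restrict_ext) (simp add: Pi_iff)
  have dot_add: "dot {..<d} a (\<lambda>i\<in>{..<d}. x i \<oplus> y i) = dot {..<d} a x \<oplus> dot {..<d} a y"
    if "x \<in> points" "y \<in> points" for x y
    using dot_axpy[OF that one_closed] restrict_one[OF that(2)] dotp[OF that(2)] by simp
  have zero_points: "(\<lambda>i\<in>{..<d}. \<zero>) \<in> points" unfolding points_def by (simp add: restrict_PiE_iff)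
  have dot0: "dot {..<d} a (\<lambda>i\<in>{..<d}. \<zero>) = \<zero>"
    using af by (intro dot_zero) (simp add: Pi_iff)
  have restrict_zero: "(\<lambda>i\<in>{..<d}. (\<lambda>i\<in>{..<d}. \<zero>) i \<oplus> c \<otimes> y i) = (\<lambda>i\<in>{..<d}. c \<otimes> y i)"
    if "y \<in> points" "c \<in> carrier F" for c y
    using points_funcset[OF that(1)] that(2) by (intro restrict_ext) (simp add: Pi_iff)
  have dot_smult: "dot {..<d} a (\<lambda>i\<in>{..<d}. c \<otimes> y i) = c \<otimes> dot {..<d} a y"
    if "y \<in> points" "c \<in> carrier F" for c y
    using dot_axpy[OF zero_points that] restrict_zero[OF that] dot0 dotp[OF that(1)] that(2) by simp
  have sub: "VectorSpace.subspace F ?W ?V"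
  proof (rule VectorSpace.subspace.intro)
    show "vectorspace F ?V" by (rule V.vectorspace_axioms)
    show "submodule F ?W ?V"
    proof (rule submodule.intro)
      show "Module.module F ?V" by (rule mV)
      show "?W \<subseteq> carrier ?V" by (auto simp: carrier_coord_space)
      show "v \<oplus>\<^bsub>?V\<^esub> w \<in> ?W" if "v \<in> ?W" "w \<in> ?W" for v w
        using that add_points[of v w] dot_add[of v w] unfolding addV by simp
      show "\<zero>\<^bsub>?V\<^esub> \<in> ?W" using zero_points dot0 unfolding zeroV by simp
      show "c \<odot>\<^bsub>?V\<^esub> v \<in> ?W" if "c \<in> carrier F" "v \<in> ?W" for c v
        using that smult_points[of c v] dot_smult[of v c] unfolding smV by simp
    qed
  qed
  interpret W: vectorspace F "?V\<lparr>carrier := ?W\<rparr>" using sub by (rule V.subspace_is_vs)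
  \<comment> \<open>The dimension is read off from the cardinality |F|^(d-1) of the kernel.\<close>
  have "finite ?W" using finite_points by simp
  then have dimW: "W.fin_dim" "W.dim = d - 1"
    using W.dim_eq_of_card[OF finite_carrier, of "d - 1"] card_linear_kernel[OF af j] by simp_all
  have "zeros a = (\<lambda>w. p \<oplus>\<^bsub>?V\<^esub> w) ` ?W"
  proof (intro equalityI subsetI)
    fix x assume x: "x \<in> zeros a"
    then have xp: "x \<in> points" by (simp add: zeros_def)
    let ?w = "\<lambda>i\<in>{..<d}. x i \<oplus> (\<ominus> \<one>) \<otimes> p i"
    have m1: "\<ominus> \<one> \<in> carrier F" by simp
    have "dot {..<d} a x \<oplus> a d = \<zero>" "dot {..<d} a p \<oplus> a d = \<zero>"
      using zerosD[OF x] zerosD[OF p] dot_lift[OF av xp] dot_lift[OF av pp]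
        a_comm[OF ad dotp[OF xp]] a_comm[OF ad dotp[OF pp]] by simp_all
    then have "dot {..<d} a x = dot {..<d} a p"
      using sum_zero_eq_neg[OF dotp[OF xp] ad] sum_zero_eq_neg[OF dotp[OF pp] ad] by simp
    then have "dot {..<d} a ?w = \<zero>"
      using dot_axpy[OF xp pp m1] diff_eq_zero dotp[OF pp] by simp
    moreover have "?w \<in> points"
      using points_funcset[OF xp] points_funcset[OF pp]
      unfolding points_def by (simp add: restrict_PiE_iff Pi_iff)
    moreover have "p \<oplus>\<^bsub>?V\<^esub> ?w = x"
      unfolding addV
    proof (rule PiE_ext)
      show "(\<lambda>i\<in>{..<d}. p i \<oplus> ?w i) \<in> {..<d} \<rightarrow>\<^sub>E carrier F"
        using add_points[OF pp \<open>?w \<in> points\<close>] by (simp only: points_def)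
      show "x \<in> {..<d} \<rightarrow>\<^sub>E carrier F" using xp by (simp only: points_def)
      fix i assume i: "i \<in> {..<d}"
      have xi: "x i \<in> carrier F" "p i \<in> carrier F"
        using points_funcset[OF xp] points_funcset[OF pp] i by auto
      have "p i \<oplus> (x i \<oplus> \<ominus> \<one> \<otimes> p i) = x i \<oplus> (p i \<oplus> \<ominus> p i)"
        using xi by (simp add: l_minus a_lcomm)
      also have "\<dots> = x i" using xi by (simp add: r_neg)
      finally show "(\<lambda>i\<in>{..<d}. p i \<oplus> ?w i) i = x i" using i by simp
    qed
    ultimately show "x \<in> (\<lambda>w. p \<oplus>\<^bsub>?V\<^esub> w) ` ?W" by (intro image_eqI[of _ _ ?w]) auto
  next
    fix x assume "x \<in> (\<lambda>w. p \<oplus>\<^bsub>?V\<^esub> w) ` ?W"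
    then obtain w where w: "w \<in> points" "dot {..<d} a w = \<zero>" "x = (\<lambda>i\<in>{..<d}. p i \<oplus> w i)"
      unfolding addV by blast
    have xp: "x \<in> points" using add_points[OF pp w(1)] w(3) by simp
    have "dot {..<d} a x = dot {..<d} a p" using dot_add[OF pp w(1)] w(2,3) dotp[OF pp] by simp
    then have "dot {..d} a (lift x) = \<zero>"
      using zerosD[OF p] dot_lift[OF av xp] dot_lift[OF av pp] by simp
    then show "x \<in> zeros a" using xp by (simp add: zeros_def)
  qed
  then show ?thesis
    unfolding hyperplane_def affine_subspace_def using pp sub dimW
    by (intro bexI[of _ p] exI[of _ ?W] conjI) (simp_all only: carrier_coord_space)
qed

lemma incidence:
  assumes "2 \<le> d"
  shows "hyperplane_incidence points (zeros ` functionals) d (card (carrier F))"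
  using assms finite_points through_points pencil[OF assms] exchange[OF assms]
  by (intro hyperplane_incidence.intro)

text \<open>A zero set containing \<open>d + 1\<close> points is nonempty, hence a true hyperplane.
  This direction suffices, as the containers only have to cover the sets in general
  position.\<close>

lemma general_position_gen_pos:
  assumes "2 \<le> d" "general_position F d S"
  shows "hyperplane_incidence.gen_pos points (zeros ` functionals) d S"
proof -
  interpret hyperplane_incidence points "zeros ` functionals" d "card (carrier F)"
    using assms(1) by (rule incidence)
  have "hyperplane F d H" if H: "H \<in> zeros ` functionals" and T: "card T = d + 1" "T \<subseteq> H" for T H
  proof -
    obtain a where a: "a \<in> functionals" "H = zeros a" using H by blast
    have "T \<noteq> {}" using T(1) by auto
    then obtain p where "p \<in> zeros a" using T(2) a(2) by auto
    then show ?thesis using hyperplane_zeros[OF a(1)] a(2) by simp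
  qed
  then show ?thesis
    using assms(2) unfolding gen_pos_def general_position_def carrier_coord_space by blast
qed

end

subsection \<open>Counting the containers\<close>

text \<open>With \<open>s\<close> about sqrt q, the fingerprint size and q/s have the same order, so
  the exponent is O(sqrt q log q). The base is at most q^(2d) and supplies the second logarithm
  together with the factor 2d.\<close>

lemma container_count_bound:
  fixes q d s :: nat
  assumes q: "2 \<le> q" and d: "2 \<le> d" and s: "sqrt (real q) \<le> real s" "real s \<le> sqrt (real q) + 1"
  shows "(real (q ^ d) + 1) powr (real (s + d - 2) + 1 +
      (real q + 1) * real (d * (d - 1)) / real s * ln (real (q ^ d)))
    \<le> 2 powr (2 * real d * (2 * real d ^ 3 + real d + 1) * sqrt (real q) * (log 2 (real q))\<^sup>2)"
    (is "_ powr ?E \<le> _")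
proof -
  let ?r = "sqrt (real q)" and ?l = "log 2 (real q)"
  have r: "1 \<le> ?r" using q by simp
  have "log 2 2 \<le> ?l" using q by (subst log_le_cancel_iff) auto
  then have l: "1 \<le> ?l" by simp
  have rl: "1 \<le> ?r * ?l" using mult_mono[OF r l] by simp
  have r_le: "?r \<le> ?r * ?l" using mult_left_mono[OF l, of ?r] r by simp
  have rr: "?r * ?r = real q" by simp
  have ln_le: "ln (real q) \<le> ?l"
  proof -
    have "ln 2 \<le> (1::real)" using ln_le_minus_one[of "2::real"] by simp
    then have "ln (real q) * ln 2 \<le> ln (real q) * 1" using q by (intro mult_left_mono) auto
    then show ?thesis by (simp add: log_def field_simps)
  qed
  have s0: "0 < real s" using s(1) r by linarith
  \<comment> \<open>This uses q + 1 \<le> 2q and q = ?r * ?r, one factor of which is cancelled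
    against \<open>s\<close>.\<close>
  have D: "(real q + 1) * real (d * (d - 1)) / real s \<le> 2 * real d ^ 2 * ?r"
  proof -
    have "(real q + 1) * real (d * (d - 1)) \<le> (2 * real q) * real d ^ 2"
      using q by (intro mult_mono) (auto simp: power2_eq_square intro!: mult_left_mono)
    also have "\<dots> = (2 * real d ^ 2 * ?r) * ?r" using rr by (simp add: mult_ac)
    also have "\<dots> \<le> (2 * real d ^ 2 * ?r) * real s" using s(1) r by (intro mult_left_mono) auto
    finally show ?thesis using s0 by (subst pos_divide_le_eq)
  qed
  have "(real q + 1) * real (d * (d - 1)) / real s * ln (real (q ^ d))
      \<le> (2 * real d ^ 2 * ?r) * (real d * ?l)"
    using D ln_le q r by (intro mult_mono) (auto simp: ln_realpow intro!: mult_left_mono)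
  also have "\<dots> = 2 * real d ^ 3 * (?r * ?l)" by (simp add: power3_eq_cube power2_eq_square mult_ac)
  finally have E2: "(real q + 1) * real (d * (d - 1)) / real s * ln (real (q ^ d))
      \<le> 2 * real d ^ 3 * (?r * ?l)" .
  have "real (s + d - 2) + 1 \<le> ?r + real d" using s(2) d by (simp add: of_nat_diff)
  also have "\<dots> \<le> ?r * ?l + real d * (?r * ?l)"
    using r_le rl mult_left_mono[OF rl, of "real d"] by simp
  finally have E1: "real (s + d - 2) + 1 \<le> (real d + 1) * (?r * ?l)" by (simp add: algebra_simps)
  have E: "?E \<le> (2 * real d ^ 3 + real d + 1) * (?r * ?l)"
    using E1 E2 by (simp add: algebra_simps)
  have "real (q ^ d) + 1 \<le> real q powr (2 * real d)"
  proof -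
    have "1 \<le> real q ^ d" using q by simp
    moreover have "real q ^ 1 \<le> real q ^ d" using q d by (intro power_increasing) auto
    then have "2 \<le> real q ^ d" using q unfolding power_one_right by linarith
    ultimately have "real (q ^ d) + 1 \<le> 2 * real q ^ d" by simp
    also have "\<dots> \<le> real q ^ d * real q ^ d"
      using \<open>2 \<le> real q ^ d\<close> by (intro mult_right_mono) auto
    also have "\<dots> = real q powr real d * real q powr real d"
      using powr_realpow[of "real q" d] q by simp
    also have "\<dots> = real q powr (2 * real d)" unfolding mult_2 by (rule powr_add[symmetric])
    finally show ?thesis .
  qed
  also have "\<dots> = (2 powr ?l) powr (2 * real d)" using q by simp
  also have "\<dots> = 2 powr (2 * real d * ?l)" by (simp add: powr_powr mult.commute)
  finally have base: "real (q ^ d) + 1 \<le> 2 powr (2 * real d * ?l)" .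
  have "(real (q ^ d) + 1) powr ?E \<le> (real (q ^ d) + 1) powr ((2 * real d ^ 3 + real d + 1) * (?r * ?l))"
    using E by (intro powr_mono) auto
  also have "\<dots> \<le> (2 powr (2 * real d * ?l)) powr ((2 * real d ^ 3 + real d + 1) * (?r * ?l))"
    using base rl by (intro powr_mono2) auto
  also have "\<dots> = 2 powr (2 * real d * (2 * real d ^ 3 + real d + 1) * ?r * ?l\<^sup>2)"
    unfolding powr_powr
    by (rule arg_cong[where f = "(powr) 2"]) (simp add: power2_eq_square algebra_simps)
  finally show ?thesis .
qed

text \<open>The exponent d/(d+1) is at least 1/2, and division by \<open>min (k - 1) 1\<close>,
  which lies in (0, 1], can only enlarge the base.\<close>

lemma sqrt_le_exponent:
  fixes q d :: nat and k :: real
  assumes "1 \<le> q" "1 \<le> d" "1 < k"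
  shows "sqrt (real q) \<le> (real q / min (k - 1) 1) powr (real d / (real d + 1))"
proof -
  have "sqrt (real q) = real q powr (1 / 2)" by (simp add: powr_half_sqrt)
  also have "\<dots> \<le> real q powr (real d / (real d + 1))"
    using assms by (intro powr_mono) (auto simp: field_simps)
  also have "\<dots> \<le> (real q / min (k - 1) 1) powr (real d / (real d + 1))"
    using assms by (intro powr_mono2) (auto simp: field_simps min_def)
  finally show ?thesis .
qed

text \<open>For d \<ge> 2 the exponent 1 - 1/d is at least 1/2. Hence the excess of the container
  size over q has room for a fingerprint of order sqrt q.\<close>

lemma sqrt_le_powr_one_minus:
  fixes q d :: nat
  assumes "1 \<le> q" "2 \<le> d"
  shows "sqrt (real q) \<le> real q powr (- 1 / real d) * real q"
proof -
  have "1 / real d \<le> 1 / 2" using assms(2) by (intro divide_left_mono) auto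
  then have "real q powr (1 / 2) \<le> real q powr (- 1 / real d + 1)"
    using assms by (intro powr_mono) auto
  also have "\<dots> = real q powr (- 1 / real d) * real q" using assms(1) by (subst powr_add) simp
  finally show ?thesis by (simp add: powr_half_sqrt)
qed

lemma general_position_containers:
  fixes F :: "nat ring" and k :: real
  assumes d: "2 \<le> d" and F: "field F" "card (carrier F) = q" and q: "2 \<le> q"
    and c: "real d + 3 \<le> c" "2 * real d * (2 * real d ^ 3 + real d + 1) \<le> c"
    and k: "1 + c * real q powr (- 1 / real d) \<le> k"
  shows "\<exists>\<C>\<subseteq>Pow (carrier (coord_space F d)).
    (\<forall>S. general_position F d S \<longrightarrow> (\<exists>C\<in>\<C>. S \<subseteq> C)) \<and>
    (\<forall>C\<in>\<C>. real (card C) \<le> k * real q) \<and>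
    real (card \<C>) \<le>
      2 powr (c * (real q / min (k - 1) 1) powr (real d / (real d + 1)) * (log 2 (real q))\<^sup>2)"
proof -
  interpret field F by (rule F(1))
  have "finite (carrier F)" using F(2) q by (intro card_ge_0_finite) simp
  then interpret finite_affine_space F d by unfold_locales
  interpret hyperplane_incidence points "zeros ` functionals" d "card (carrier F)"
    using d by (rule incidence)
  have coord: "carrier (coord_space F d) = points" by (rule carrier_coord_space)
  \<comment> \<open>This choice balances the cost \<open>s\<close> of naming the fingerprint against
    the number of selections, which is of order q/s up to a logarithm.\<close>
  define s where "s = nat \<lceil>sqrt (real q)\<rceil>"
  have r: "1 \<le> sqrt (real q)" using q by simp
  have s: "sqrt (real q) \<le> real s" "real s \<le> sqrt (real q) + 1"
    using r unfolding s_def by linarith+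
  have s0: "0 < s" using s(1) r by linarith
  have cardP: "card points = q ^ d" using card_points F(2) by simp
  have pow: "0 < real q powr (- 1 / real d)" using q by simp
  have c0: "0 < c" using c(1) by linarith
  have "0 < c * real q powr (- 1 / real d)" using c0 pow by (rule mult_pos_pos)
  then have k1: "1 < k" using k by linarith
  have "(real d + 3) * sqrt (real q) \<le> c * (real q powr (- 1 / real d) * real q)"
    using sqrt_le_powr_one_minus[of q d] q d c r by (intro mult_mono) auto
  moreover have "(1 + c * real q powr (- 1 / real d)) * real q \<le> k * real q"
    using k by (rule mult_right_mono) simp
  ultimately have kq: "real q + (real d + 3) * sqrt (real q) \<le> k * real q"
    by (simp add: algebra_simps)
  \<comment> \<open>The constants are absorbed into multiples of sqrt q \<ge> 1, so fingerprint,
    slack and threshold together fit below k q.\<close>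
  have "real (s + d - 2) + 2 \<le> sqrt (real q) + (real d + 1)" using s(2) d by (simp add: of_nat_diff)
  also have "\<dots> \<le> sqrt (real q) + (real d + 1) * sqrt (real q)"
    using mult_left_mono[OF r, of "real d + 1"] by simp
  also have "\<dots> \<le> (real d + 3) * sqrt (real q)" using r by (simp add: algebra_simps)
  finally have size: "real (card (carrier F)) + 2 + real (s + d - 2) \<le> k * real q"
    using kq F(2) by linarith
  have "1 \<le> card points" using cardP q by simp
  from gen_pos_containers[OF s0 size this] obtain \<C> where C: "\<C> \<subseteq> Pow points"
    "\<forall>S. gen_pos S \<longrightarrow> (\<exists>C\<in>\<C>. S \<subseteq> C)"
    "\<forall>C\<in>\<C>. real (card C) \<le> k * real q"
    "real (card \<C>) \<le> (real (card points) + 1) powr (real (s + d - 2) + 1 +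
      (real (card (carrier F)) + 1) * real (d * (d - 1)) / real s * ln (real (card points)))"
    by (elim exE conjE)
  have cover: "\<forall>S. general_position F d S \<longrightarrow> (\<exists>C\<in>\<C>. S \<subseteq> C)"
    using C(2) general_position_gen_pos[OF d] by blast
  have "real (card \<C>) \<le> 2 powr (2 * real d * (2 * real d ^ 3 + real d + 1) * sqrt (real q) * (log 2 (real q))\<^sup>2)"
    using C(4) container_count_bound[OF q d s] unfolding cardP F(2) by linarith
  also have "\<dots> \<le> 2 powr (c * (real q / min (k - 1) 1) powr (real d / (real d + 1)) * (log 2 (real q))\<^sup>2)"
    using sqrt_le_exponent[of q d k] q d k1 c r by (intro powr_mono mult_right_mono mult_mono) auto
  finally show ?thesis
    using C(1,3) cover unfolding coord by (intro exI[of _ \<C>] conjI)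
qed

theorem theorem4p3:
  fixes d :: nat
  assumes "d \<ge> 2"
  shows "\<exists>c::real. c > 0 \<and>
    (\<forall>\<^sub>F q::nat in sequentially. primepow q \<longrightarrow>
      (\<forall>F::nat ring. field F \<and> card (carrier F) = q \<longrightarrow>
        (\<forall>k::real. k \<ge> 1 + c * real q powr (- 1 / real d) \<longrightarrow>
          (\<exists>\<C> :: (nat \<Rightarrow> nat) set set.
             \<C> \<subseteq> Pow (carrier (coord_space F d)) \<and>
             (\<forall>S. general_position F d S \<longrightarrow> (\<exists>C\<in>\<C>. S \<subseteq> C)) \<and>
             (\<forall>C\<in>\<C>. real (card C) \<le> k * real q) \<and>
             real (card \<C>) \<le>
               2 powr (c * (real q / min (k - 1) 1) powr (real d / (real d + 1)) * (log 2 (real q))\<^sup>2)))))"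
proof -
  \<comment> \<open>The sum of two requirements: the first part makes room in the container size,
    the second bounds the number of containers.\<close>
  define c where "c = real d + 3 + 2 * real d * (2 * real d ^ 3 + real d + 1)"
  have c: "real d + 3 \<le> c" "2 * real d * (2 * real d ^ 3 + real d + 1) \<le> c"
    by (auto simp: c_def)
  have "0 < c" using c(1) by linarith
  then show ?thesis
  proof (intro exI[of _ c] conjI eventually_mono[OF eventually_ge_at_top[of "2::nat"]] impI allI)
    fix q :: nat and F :: "nat ring" and k :: real
    assume "2 \<le> q" and F: "field F \<and> card (carrier F) = q"
      and k: "1 + c * real q powr (- 1 / real d) \<le> k"
    show "\<exists>\<C>\<subseteq>Pow (carrier (coord_space F d)).
      (\<forall>S. general_position F d S \<longrightarrow> (\<exists>C\<in>\<C>. S \<subseteq> C)) \<and>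
      (\<forall>C\<in>\<C>. real (card C) \<le> k * real q) \<and>
      real (card \<C>) \<le>
        2 powr (c * (real q / min (k - 1) 1) powr (real d / (real d + 1)) * (log 2 (real q))\<^sup>2)"
      by (rule general_position_containers[OF assms conjunct1[OF F] conjunct2[OF F] \<open>2 \<le> q\<close> c k])
  qed
qed

end
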